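(* Let $R$ be a commutative ring with $1$ and $q\in\Lambda(n)$. Then the right $RS_n$-module $X^q_R=\Xi^qRS_n$ is a free $R$-module with basis $\{\Xi^q w: w\in\mathscr{B}_q\}$ (products in $RS_n$). In particular its rank is $\sum_{\lambda}\frac{n!}{\lambda?}$, the sum over partitions $\lambda$ of $n$ with $\lambda\preccurlyeq q$, i.e. the number of permutations of $S_n$ whose cycle type weakly refines $q$.
   Context: Permutations act on the right and compose left to right; $\sigma\in S_n$ is identified with the word $w_1\cdots w_n$, $w_i=(i)\sigma$. For a composition $q=(q_1,\dots,q_k)$ of $n$, $\Xi^q\in RS_n$ is the sum of all $\sigma$ whose descents ($i$ with $(i)\sigma>(i+1)\sigma$) lie in $\{q_1,q_1+q_2,\dots,q_1+\dots+q_k\}$. $r\preccurlyeq q$ (weak refinement) means some rearrangement of $r$ is the concatenation of compositions of $q_1,\dots,q_k$ in order. $\lambda?=\prod_i i^{m_i(\lambda)}m_i(\lambda)!$ with $m_i$ the number of parts equal to $i$. Pivots: for $w=w_1\cdots w_n\in S_n$ put $\rho_0=0$ and, while $\rho_i<n$, let $\rho_{i+1}$ be the position of the smallest letter among $w_{\rho_i+1},\dots,w_n$; this stops at $\rho_\ell=n$. The pivot cycle type of $w$ is the composition $(\rho_1-\rho_0,\rho_2-\rho_1,\dots,\rho_\ell-\rho_{\ell-1})$ of $n$. $\mathscr{B}_q$ is the set of $w\in S_n$ whose pivot cycle type is a weak refinement of $q$. *)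

theory Defs
  imports Complex_Main "HOL-Library.Multiset" "HOL-Combinatorics.Permutations"
begin

type_synonym perm = "nat \<Rightarrow> nat"

text \<open>S_n: bijections of {1..n} (identity outside). A permutation sigma is the word
 w_1...w_n with w_i = sigma i.  Products compose left to right:
 (i)(sigma tau) = ((i)sigma)tau, i.e. sigma tau = tau o sigma as functions.\<close>
definition perms :: "nat \<Rightarrow> perm set" where
  "perms n = {\<sigma>. \<sigma> permutes {1..n}}"

definition compositions :: "nat \<Rightarrow> nat list set" where
  "compositions n = {c. (\<forall>x\<in>set c. 0 < x) \<and> sum_list c = n}"

definition weak_refines :: "nat multiset \<Rightarrow> nat list \<Rightarrow> bool" where
  "weak_refines r q \<longleftrightarrow> (\<exists>rs. length rs = length q \<and>
      (\<forall>i<length q. rs ! i \<in> compositions (q ! i)) \<and> mset (concat rs) = r)"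

definition partitions :: "nat \<Rightarrow> nat multiset set" where
  "partitions n = {p. (\<forall>x\<in>#p. 0 < x) \<and> sum_mset p = n}"

definition zee :: "nat multiset \<Rightarrow> nat" where
  "zee p = (\<Prod>i\<in>set_mset p. i ^ count p i * fact (count p i))"

definition cyc :: "perm \<Rightarrow> nat \<Rightarrow> nat set" where
  "cyc \<sigma> i = {(\<sigma> ^^ k) i | k. True}"

definition cycle_type :: "nat \<Rightarrow> perm \<Rightarrow> nat multiset" where
  "cycle_type n \<sigma> = image_mset card (mset_set (cyc \<sigma> ` {1..n}))"

definition descents :: "nat \<Rightarrow> perm \<Rightarrow> nat set" where
  "descents n \<sigma> = {i. 1 \<le> i \<and> i < n \<and> \<sigma> (i + 1) < \<sigma> i}"

definition partial_sums :: "nat list \<Rightarrow> nat set" where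
  "partial_sums q = {sum_list (take j q) | j. 1 \<le> j \<and> j \<le> length q}"

definition group_ring :: "nat \<Rightarrow> (perm \<Rightarrow> 'r::comm_ring_1) set" where
  "group_ring n = {a. \<forall>\<pi>. \<pi> \<notin> perms n \<longrightarrow> a \<pi> = 0}"

definition gmul :: "nat \<Rightarrow> (perm \<Rightarrow> 'r::comm_ring_1) \<Rightarrow> (perm \<Rightarrow> 'r) \<Rightarrow> perm \<Rightarrow> 'r" where
  "gmul n a b = (\<lambda>\<pi>. \<Sum>(\<sigma>, \<tau>) \<in> {(\<sigma>, \<tau>). \<sigma> \<in> perms n \<and> \<tau> \<in> perms n \<and> \<tau> \<circ> \<sigma> = \<pi>}.
                        a \<sigma> * b \<tau>)"

definition delta :: "perm \<Rightarrow> perm \<Rightarrow> 'r::comm_ring_1" where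
  "delta w = (\<lambda>\<pi>. if \<pi> = w then 1 else 0)"

definition Xi :: "nat \<Rightarrow> nat list \<Rightarrow> perm \<Rightarrow> 'r::comm_ring_1" where
  "Xi n q = (\<lambda>\<pi>. if \<pi> \<in> perms n \<and> descents n \<pi> \<subseteq> partial_sums q then 1 else 0)"

definition next_pivot :: "nat \<Rightarrow> perm \<Rightarrow> nat \<Rightarrow> nat" where
  "next_pivot n \<sigma> \<rho> = (LEAST j. \<rho> < j \<and> j \<le> n \<and> (\<forall>k. \<rho> < k \<and> k \<le> n \<longrightarrow> \<sigma> j \<le> \<sigma> k))"

function pivot_parts :: "nat \<Rightarrow> perm \<Rightarrow> nat \<Rightarrow> nat list" where
  "pivot_parts n \<sigma> \<rho> =
     (if \<rho> < n \<and> \<rho> < next_pivot n \<sigma> \<rho> \<and> next_pivot n \<sigma> \<rho> \<le> n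
      then (next_pivot n \<sigma> \<rho> - \<rho>) # pivot_parts n \<sigma> (next_pivot n \<sigma> \<rho>)
      else [])"
  by pat_completeness auto
termination
  by (relation "measure (\<lambda>(n, \<sigma>, \<rho>). n - \<rho>)") auto

definition pivot_cycle_type :: "nat \<Rightarrow> perm \<Rightarrow> nat list" where
  "pivot_cycle_type n \<sigma> = pivot_parts n \<sigma> 0"

definition Bq :: "nat \<Rightarrow> nat list \<Rightarrow> perm set" where
  "Bq n q = {w \<in> perms n. weak_refines (mset (pivot_cycle_type n w)) q}"

end

theory Submission
  imports Defs "HOL-Combinatorics.Cycles"
begin

text \<open>
  Left multiplication by \<open>\<Xi>\<^sup>q\<close> is the map \<open>T\<close> that sends a word to the sum of its unshuffles into
  consecutive segments of lengths \<open>q\<^sub>1, \<dots>, q\<^sub>k\<close>. Cut a word \<open>w\<close> after each pivot into blocks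
  \<open>v\<^sub>1 \<dots> v\<^sub>l\<close>, each ending in its least letter, and let \<open>P\<^sub>w\<close> be the product of the right-normed Lie
  brackets of the blocks. Expanding brackets gives \<open>P\<^sub>w = w +\<close> words that are larger from the right, so
  the \<open>P\<^sub>w\<close> form an integral basis. As Lie elements are primitive, \<open>T(P\<^sub>w)\<close> is the sum over all ways to
  distribute the blocks, in order, among the segments. Each summand is the product of brackets attached
  to the word \<open>u\<close> obtained from the distributed blocks, where the blocks of \<open>u\<close> are found by cutting
  every segment of \<open>u\<close> at its own pivots. These products are again unitriangular in \<open>u\<close>, hence
  independent, and \<open>u\<close> determines \<open>w\<close>. So the nonzero \<open>T(P\<^sub>w)\<close> are independent; they are those with
  \<open>w \<in> \<B>\<^sub>q\<close>, and unitriangularity replaces \<open>P\<^sub>w\<close> by \<open>w\<close>.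

  For the rank, both the pivot cycle type and the cycle type satisfy the recursion that removes the
  block, respectively the cycle, of the least letter, whose solution is \<open>n! / \<lambda>?\<close>.
\<close>

section \<open>Brackets and unshuffles\<close>

primrec splits :: "'a list \<Rightarrow> ('a list \<times> 'a list) list" where
  "splits [] = [([], [])]"
| "splits (a # w) = map (\<lambda>(x, y). (a # x, y)) (splits w) @ map (\<lambda>(x, y). (x, a # y)) (splits w)"

text \<open>The coproduct for which single letters are primitive; its value is given by pairing it with \<open>h\<close>.\<close>

definition coprod :: "'a list \<Rightarrow> ('a list \<Rightarrow> 'a list \<Rightarrow> 'r) \<Rightarrow> 'r::comm_ring_1" where
  "coprod w h = (\<Sum>(x, y)\<leftarrow>splits w. h x y)"

lemma coprod_Nil [simp]: "coprod [] h = h [] []"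
  by (simp add: coprod_def)

lemma coprod_Cons [simp]:
  "coprod (a # w) h = coprod w (\<lambda>x y. h (a # x) y) + coprod w (\<lambda>x y. h x (a # y))"
  by (simp add: coprod_def o_def case_prod_unfold)

lemma coprod_add: "coprod w (\<lambda>x y. h x y + k x y) = coprod w h + coprod w k"
  by (simp add: coprod_def case_prod_unfold sum_list_addf)

lemma coprod_append:
  "coprod (u @ v) h = coprod u (\<lambda>x y. coprod v (\<lambda>x' y'. h (x @ x') (y @ y')))"
  by (induction u arbitrary: h) simp_all

lemma coprod_snoc:
  "coprod (w @ [a]) h = coprod w (\<lambda>x y. h (x @ [a]) y) + coprod w (\<lambda>x y. h x (y @ [a]))"
  by (simp add: coprod_append coprod_add)

text \<open>A list of (coefficient, word) pairs stands for an element of the free associative ring; two such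
  elements are compared by evaluating linear functionals on them, which works over every ring \<open>'r\<close>.\<close>

definition ev :: "(int \<times> 'a list) list \<Rightarrow> ('a list \<Rightarrow> 'r) \<Rightarrow> 'r::comm_ring_1" where
  "ev L g = (\<Sum>(c, u)\<leftarrow>L. of_int c * g u)"

lemma ev_Nil [simp]: "ev [] g = 0"
  by (simp add: ev_def)

lemma ev_Cons [simp]: "ev ((c, u) # L) g = of_int c * g u + ev L g"
  by (simp add: ev_def)

lemma ev_append [simp]: "ev (L @ M) g = ev L g + ev M g"
  by (simp add: ev_def)

lemma ev_zero [simp]: "ev L (\<lambda>_. 0) = 0"
  by (induction L) auto

lemma ev_add: "ev L (\<lambda>u. g u + h u) = ev L g + ev L h"
  by (induction L) (auto simp: algebra_simps)

lemma ev_diff: "ev L (\<lambda>u. g u - h u) = ev L g - ev L h"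
  by (induction L) (auto simp: algebra_simps)

lemma ev_scale: "ev L (\<lambda>u. r * g u) = r * ev L g"
  by (induction L) (auto simp: algebra_simps)

lemma ev_cong: "(\<And>c u. (c, u) \<in> set L \<Longrightarrow> g u = h u) \<Longrightarrow> ev L g = ev L h"
  unfolding ev_def by (rule arg_cong[of _ _ sum_list], rule map_cong) auto

lemma ev_if: "ev L (\<lambda>u. if P then g u else 0) = (if P then ev L g else 0)"
  by simp

lemma ev_sum_list: "ev L (\<lambda>u. \<Sum>x\<leftarrow>xs. g x u) = (\<Sum>x\<leftarrow>xs. ev L (g x))"
  by (induction xs) (simp_all add: ev_add)

lemma ev_swap: "ev L (\<lambda>u. ev M (\<lambda>z. h u z)) = ev M (\<lambda>z. ev L (\<lambda>u. h u z))"
  by (induction M) (auto simp: ev_add ev_scale)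

lemma ev_coprod: "ev L (\<lambda>u. coprod w (\<lambda>x y. h x y u)) = coprod w (\<lambda>x y. ev L (h x y))"
  by (simp add: coprod_def case_prod_unfold ev_sum_list)

lemma ev_map: "ev (map (\<lambda>(c, u). (c, f u)) L) g = ev L (\<lambda>u. g (f u))"
  by (induction L) auto

lemma ev_map_uminus: "ev (map (\<lambda>(c, u). (- c, f u)) L) g = - ev L (\<lambda>u. g (f u))"
  by (induction L) auto

lemma ev_map_mult: "ev (map (\<lambda>(c, u). (d * c, f u)) L) g = of_int d * ev L (\<lambda>u. g (f u))"
  by (induction L) (auto simp: algebra_simps)

text \<open>The bracket \<open>[a\<^sub>1, [a\<^sub>2, \<dots> [a\<^bsub>k-1\<^esub>, a\<^sub>k]]]\<close>; the empty word is sent to 0.\<close>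

fun lie :: "'a list \<Rightarrow> (int \<times> 'a list) list" where
  "lie [] = []"
| "lie [m] = [(1, [m])]"
| "lie (a # b # v) = map (\<lambda>(c, u). (c, a # u)) (lie (b # v)) @
     map (\<lambda>(c, u). (- c, u @ [a])) (lie (b # v))"

section \<open>Primitivity of brackets and the coproduct of their products\<close>

lemma ev_lie_Cons:
  "ev (lie (a # b # v)) g = ev (lie (b # v)) (\<lambda>u. g (a # u) - g (u @ [a]))"
  unfolding lie.simps ev_append ev_map ev_map_uminus by (simp add: ev_diff)

text \<open>Write [a, u] = au - ua. The letter \<open>a\<close> is primitive and, by induction, so
  is the expanded tail; hence the coproducts of au and of ua have the same two mixed terms, with
  \<open>a\<close> on one side and the tail on the other, and these cancel. For the empty word both
  sides vanish because its bracket is 0.\<close>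

lemma lie_primitive: "ev (lie v) (\<lambda>u. coprod u h) = ev (lie v) (\<lambda>u. h u [] + h [] u)"
proof (induction v arbitrary: h rule: lie.induct)
  case (3 a b v)
  let ?L = "lie (b # v)"
  have "ev (lie (a # b # v)) (\<lambda>u. coprod u h) =
      ev ?L (\<lambda>u. coprod u (\<lambda>x y. h (a # x) y)) + ev ?L (\<lambda>u. coprod u (\<lambda>x y. h x (a # y)))
      - (ev ?L (\<lambda>u. coprod u (\<lambda>x y. h (x @ [a]) y)) + ev ?L (\<lambda>u. coprod u (\<lambda>x y. h x (y @ [a]))))"
    by (simp only: ev_lie_Cons coprod_Cons coprod_snoc ev_add ev_diff)
  \<comment> \<open>The induction hypothesis is used for four functionals, obtained from
    \<open>h\<close> by attaching \<open>a\<close> to either end of either argument.\<close>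
  also have "\<dots> = ev (lie (a # b # v)) (\<lambda>u. h u [] + h [] u)"
    unfolding 3 ev_lie_Cons by (simp add: ev_add ev_diff)
  finally show ?case .
qed simp_all

text \<open>The product of the brackets of the listed words in the given order, as in a
  Poincare-Birkhoff-Witt basis.\<close>

primrec pbw :: "'a list list \<Rightarrow> (int \<times> 'a list) list" where
  "pbw [] = [(1, [])]"
| "pbw (v # vs) = concat (map (\<lambda>(c, u). map (\<lambda>(d, z). (c * d, u @ z)) (pbw vs)) (lie v))"

lemma ev_pbw_Cons: "ev (pbw (v # vs)) g = ev (lie v) (\<lambda>u. ev (pbw vs) (\<lambda>z. g (u @ z)))"
proof -
  have "ev (concat (map (\<lambda>(c, u). map (\<lambda>(d, z). (c * d, u @ z)) (pbw vs)) L)) g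
      = ev L (\<lambda>u. ev (pbw vs) (\<lambda>z. g (u @ z)))" for L
    by (induction L) (auto simp: ev_map_mult)
  then show ?thesis by simp
qed

declare pbw.simps(2) [simp del]

lemma ev_pbw_append: "ev (pbw (xs @ ys)) g = ev (pbw xs) (\<lambda>u. ev (pbw ys) (\<lambda>z. g (u @ z)))"
  by (induction xs arbitrary: g) (simp_all add: ev_pbw_Cons)

text \<open>The coproduct is multiplicative and brackets are primitive, so each factor goes as a
  whole to the left or to the right. Accordingly the second \<open>coprod\<close> acts on the list
  \<open>vs\<close>, whose letters are whole factors.\<close>

lemma pbw_coprod:
  "ev (pbw vs) (\<lambda>w. coprod w h) = coprod vs (\<lambda>xs ys. ev (pbw xs) (\<lambda>x. ev (pbw ys) (h x)))"
proof (induction vs arbitrary: h)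
  case (Cons v vs)
  have "ev (pbw (v # vs)) (\<lambda>w. coprod w h) = ev (lie v) (\<lambda>u. coprod u (\<lambda>x y. 
      ev (pbw vs) (\<lambda>z. coprod z (\<lambda>x' y'. h (x @ x') (y @ y')))))"
    by (simp add: ev_pbw_Cons coprod_append ev_coprod)
  also have "\<dots> = ev (lie v) (\<lambda>u. ev (pbw vs) (\<lambda>z. coprod z (\<lambda>x' y'. h (u @ x') y')))
      + ev (lie v) (\<lambda>u. ev (pbw vs) (\<lambda>z. coprod z (\<lambda>x' y'. h x' (u @ y'))))"
    by (simp add: lie_primitive ev_add)
  also have "\<dots> = coprod vs (\<lambda>xs ys. ev (lie v) (\<lambda>u. ev (pbw xs) (\<lambda>x. ev (pbw ys) (h (u @ x)))))
      + coprod vs (\<lambda>xs ys. ev (lie v) (\<lambda>u. ev (pbw xs) (\<lambda>x. ev (pbw ys) (\<lambda>y. h x (u @ y)))))"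
    by (simp add: Cons ev_coprod)
  also have "(\<lambda>xs ys. ev (lie v) (\<lambda>u. ev (pbw xs) (\<lambda>x. ev (pbw ys) (\<lambda>y. h x (u @ y)))))
      = (\<lambda>xs ys. ev (pbw xs) (\<lambda>x. ev (lie v) (\<lambda>u. ev (pbw ys) (\<lambda>y. h x (u @ y)))))"
    by (intro ext) (rule ev_swap)
  finally show ?case by (simp add: ev_pbw_Cons)
qed simp

text \<open>The weight \<open>wt\<close> lets one definition serve two levels: it is
  \<open>length\<close> when words are cut, and the total number of letters,
  \<open>length \<circ> concat\<close>, when lists of blocks are distributed.\<close>

fun unshufflings :: "('a list \<Rightarrow> nat) \<Rightarrow> nat list \<Rightarrow> 'a list \<Rightarrow> 'a list list list" where
  "unshufflings wt [] w = (if w = [] then [[]] else [])"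
| "unshufflings wt (m # q) w =
     concat (map (\<lambda>(x, y). if wt x = m then map ((#) x) (unshufflings wt q y) else []) (splits w))"

lemma sum_unshufflings_Cons:
  "(\<Sum>xss\<leftarrow>unshufflings wt (m # q) w. G xss) =
     coprod w (\<lambda>x y. if wt x = m then \<Sum>yss\<leftarrow>unshufflings wt q y. G (x # yss) else 0)"
proof -
  have "(\<Sum>xss\<leftarrow>concat (map (\<lambda>(x, y). if wt x = m then map ((#) x) (unshufflings wt q y) else []) S). G xss) =
      (\<Sum>(x, y)\<leftarrow>S. if wt x = m then \<Sum>yss\<leftarrow>unshufflings wt q y. G (x # yss) else 0)" for S
    by (induction S) (auto simp: o_def)
  then show ?thesis by (simp add: coprod_def)
qed

lemma mset_lie: "(c, u) \<in> set (lie v) \<Longrightarrow> mset u = mset v"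
  by (induction v arbitrary: c u rule: lie.induct) fastforce+

lemma mset_pbw: "(c, u) \<in> set (pbw vs) \<Longrightarrow> mset u = mset (concat vs)"
proof (induction vs arbitrary: c u)
  case (Cons v vs)
  then obtain c1 u1 c2 u2 where "(c1, u1) \<in> set (lie v)" "(c2, u2) \<in> set (pbw vs)" "u = u1 @ u2"
    by (auto simp: pbw.simps(2))
  then show ?case using mset_lie Cons.IH by fastforce
qed simp

lemma pbw_eq_Nil: "[] \<in> set vs \<Longrightarrow> pbw vs = []"
  by (induction vs) (auto simp: pbw.simps(2))

text \<open>Brackets are primitive, so unshuffling a product of brackets only distributes whole factors.\<close>

theorem pbw_unshuffle:
  "ev (pbw vs) (\<lambda>w. \<Sum>xss\<leftarrow>unshufflings length q w. g (concat xss)) =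
     (\<Sum>xss\<leftarrow>unshufflings (length \<circ> concat) q vs. ev (pbw (concat xss)) g)"
proof (induction q arbitrary: vs g)
  case Nil
  \<comment> \<open>Without segments only the empty word survives. An empty factor makes the product
    0, and otherwise a nonempty product expands into nonempty words.\<close>
  show ?case
  proof (cases "vs = [] \<or> [] \<in> set vs")
    case True
    then show ?thesis by (auto simp: pbw_eq_Nil)
  next
    case False
    then have "concat vs \<noteq> []" by (cases vs) auto
    then have "u \<noteq> []" if "(c, u) \<in> set (pbw vs)" for c u
      using mset_pbw[OF that] by auto
    then have "ev (pbw vs) (\<lambda>w. \<Sum>xss\<leftarrow>unshufflings length [] w. g (concat xss)) = ev (pbw vs) (\<lambda>_. 0)"
      by (intro ev_cong) auto
    then show ?thesis using False by simp
  qed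
next
  case (Cons m q)
  let ?U = "unshufflings length q" and ?V = "unshufflings (length \<circ> concat) q"
  \<comment> \<open>Expanding brackets preserves the letters, so the condition on the length of a
    word is a condition on the factors and can be pulled out.\<close>
  have restr: "ev (pbw xs) (\<lambda>x. if length x = m then F x else 0)
      = (if length (concat xs) = m then ev (pbw xs) F else 0)" for xs and F :: "'b list \<Rightarrow> 'a"
  proof -
    have "length u = length (concat xs)" if "(c, u) \<in> set (pbw xs)" for c u
      using mset_pbw[OF that] by (metis size_mset)
    then have "ev (pbw xs) (\<lambda>x. if length x = m then F x else 0)
      = ev (pbw xs) (\<lambda>x. if length (concat xs) = m then F x else 0)"
      by (intro ev_cong) (metis (no_types))
    then show ?thesis by simp
  qed
  have IH: "ev (pbw ys) (\<lambda>y. \<Sum>yss\<leftarrow>?U y. g (x @ concat yss)) =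
      (\<Sum>yss\<leftarrow>?V ys. ev (pbw (concat yss)) (\<lambda>y. g (x @ y)))" for x ys
    using Cons[of ys "\<lambda>z. g (x @ z)"] .
  have "ev (pbw vs) (\<lambda>w. \<Sum>xss\<leftarrow>unshufflings length (m # q) w. g (concat xss))
    = coprod vs (\<lambda>xs ys. ev (pbw xs) (\<lambda>x. if length x = m
          then ev (pbw ys) (\<lambda>y. \<Sum>yss\<leftarrow>?U y. g (x @ concat yss)) else 0))"
    unfolding sum_unshufflings_Cons pbw_coprod ev_if concat.simps ..
  also have "\<dots> = coprod vs (\<lambda>xs ys. if length (concat xs) = m
      then ev (pbw xs) (\<lambda>x. \<Sum>yss\<leftarrow>?V ys. ev (pbw (concat yss)) (\<lambda>y. g (x @ y))) else 0)"
    unfolding restr IH ..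
  also have "\<dots> = (\<Sum>xss\<leftarrow>unshufflings (length \<circ> concat) (m # q) vs. ev (pbw (concat xss)) g)"
    unfolding sum_unshufflings_Cons by (simp add: ev_sum_list ev_pbw_append cong: if_cong)
  finally show ?case .
qed

text \<open>The last letter is the most significant digit: expanding a bracket moves its least letter away
  from the last position, which therefore increases the key.\<close>

definition key :: "nat \<Rightarrow> nat list \<Rightarrow> nat" where
  "key b u = foldr (\<lambda>a k. a + b * k) u 0"

lemma key_simps [simp]: "key b [] = 0" "key b (a # u) = a + b * key b u"
  by (simp_all add: key_def)

lemma key_append: "key b (u @ v) = key b u + b ^ length u * key b v"
  by (induction u) (simp_all add: algebra_simps)

lemma key_less: "\<forall>a\<in>set u. a < b \<Longrightarrow> key b u < b ^ length u"
proof (induction u)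
  case (Cons a u)
  then have "a + b * key b u < b + b * key b u" by simp
  also have "\<dots> = b * (key b u + 1)" by simp
  also have "\<dots> \<le> b * b ^ length u" using Cons by (intro mult_left_mono) auto
  finally show ?case by simp
qed simp

section \<open>Leading words of brackets and of their products\<close>

definition min_last :: "nat list \<Rightarrow> bool" where
  "min_last v \<longleftrightarrow> v \<noteq> [] \<and> (\<forall>a\<in>set (butlast v). last v < a)"

text \<open>A term \<open>a # u\<close> inherits the comparison from the tail. A term
  \<open>u @ [a]\<close> ends in \<open>a\<close>, which exceeds the last letter of the given word;
  since letters are digits below \<open>b\<close>, this most significant digit decides.\<close>

lemma lie_unitriangular:
  assumes "min_last v" "\<forall>a\<in>set v. a < b"
  shows "\<exists>R. lie v = (1, v) # R \<and> (\<forall>(c, u)\<in>set R. key b v < key b u)"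
  using assms
proof (induction v rule: lie.induct)
  case (3 a m v)
  then have "min_last (m # v)" "\<forall>a\<in>set (m # v). a < b" by (auto simp: min_last_def)
  from 3(1)[OF this] obtain R where R: "lie (m # v) = (1, m # v) # R"
    "\<forall>(c, u)\<in>set R. key b (m # v) < key b u" by blast
  let ?l = "last (m # v)" and ?x = "butlast (m # v)"
  have v: "m # v = ?x @ [?l]" by simp
  have "?l < a" using 3(3) by (auto simp: min_last_def)
  have snoc: "key b (a # m # v) < key b (u @ [a])" if "mset u = mset (m # v)" for u
  proof -
    have len: "length u = Suc (length ?x)" using that by (metis length_append_singleton size_mset v)
    have "\<forall>c\<in>set (a # ?x). c < b" using 3(4) by (auto dest: in_set_butlastD)
    then have "key b (a # ?x) < b ^ length u" using key_less[of "a # ?x" b] len by simp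
    have "key b (a # m # v) = key b ((a # ?x) @ [?l])" by simp
    also have "\<dots> = key b (a # ?x) + b ^ length u * ?l"
      unfolding key_append by (simp add: len)
    also have "\<dots> < b ^ length u * (?l + 1)"
      using \<open>key b (a # ?x) < b ^ length u\<close> by simp
    also have "\<dots> \<le> b ^ length u * a" using \<open>?l < a\<close> by (intro mult_left_mono) auto
    finally show ?thesis by (simp add: key_append)
  qed
  let ?R = "map (\<lambda>(c, u). (c, a # u)) R @ map (\<lambda>(c, u). (- c, u @ [a])) (lie (m # v))"
  have "lie (a # m # v) = (1, a # m # v) # ?R" unfolding lie.simps R(1) by simp
  moreover have "b > 0" using 3(4) by auto
  then have "\<forall>(c, u)\<in>set ?R. key b (a # m # v) < key b u"
    using R(2) snoc mset_lie by (fastforce simp del: lie.simps)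
  ultimately show ?case by blast
qed (auto simp: min_last_def)

text \<open>Later letters are more significant. A larger word from the later factors therefore
  decides the comparison whatever the first factor contributes (\<open>big\<close>); if the later
  factors give their leading word, the first factor decides (\<open>small\<close>).\<close>

lemma pbw_unitriangular:
  assumes "\<forall>v\<in>set vs. min_last v" "\<forall>a\<in>set (concat vs). a < b"
  shows "\<exists>R. pbw vs = (1, concat vs) # R \<and> (\<forall>(c, u)\<in>set R. key b (concat vs) < key b u)"
  using assms
proof (induction vs)
  case (Cons v vs)
  then obtain R S where R: "lie v = (1, v) # R" "\<forall>(c, u)\<in>set R. key b v < key b u"
    and S: "pbw vs = (1, concat vs) # S" "\<forall>(c, u)\<in>set S. key b (concat vs) < key b u"
    using lie_unitriangular[of v b] by auto
  let ?M = "\<lambda>c u. map (\<lambda>(d, z). (c * d, u @ z))"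
  let ?R = "?M 1 v S @ concat (map (\<lambda>(c, u). ?M c u (pbw vs)) R)"
  have "pbw (v # vs) = (1, concat (v # vs)) # ?R"
    by (simp add: pbw.simps(2) R S(1))
  moreover have big: "key b (v @ concat vs) < key b (u @ z)"
    if "(c, u) \<in> set (lie v)" "key b (concat vs) < key b z" for c u z
  proof -
    have "length u = length v" using mset_lie[OF that(1)] by (metis size_mset)
    have "key b v < b ^ length v" using Cons.prems by (intro key_less) auto
    then have "key b (v @ concat vs) < b ^ length v * (key b (concat vs) + 1)"
      by (simp add: key_append)
    also have "\<dots> \<le> b ^ length v * key b z" using that(2) by (intro mult_left_mono) auto
    finally show ?thesis using \<open>length u = length v\<close> by (simp add: key_append)
  qed
  have small: "key b (v @ concat vs) < key b (u @ concat vs)" if "(c, u) \<in> set R" for c u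
  proof -
    have "(c, u) \<in> set (lie v)" using that R by simp
    then have "length u = length v" using mset_lie by (metis size_mset)
    then show ?thesis using R(2) that by (auto simp: key_append)
  qed
  have "key b (concat (v # vs)) < key b x" if x: "(c, x) \<in> set ?R" for c x
  proof -
    consider z where "(c, z) \<in> set S" "x = v @ z" | d u z c2
      where "(d, u) \<in> set R" "(c2, z) \<in> set (pbw vs)" "x = u @ z"
      using x by auto
    then show ?thesis
    proof cases
      case 1
      then show ?thesis using S(2) big[of 1 v] R(1) by auto
    next
      case 2
      then show ?thesis using S R(1) big[of d u z] small by auto
    qed
  qed
  ultimately show ?case by blast
qed simp

section \<open>Pivot factorisation\<close>

text \<open>The cut is built from the right: the first block of \<open>w\<close> ends in the least
  letter of \<open>w\<close>, so a new letter in front either exceeds it and joins that block, or is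
  itself the first pivot.\<close>

fun pivot_blocks :: "nat list \<Rightarrow> nat list list" where
  "pivot_blocks [] = []"
| "pivot_blocks (a # w) = (case pivot_blocks w of [] \<Rightarrow> [[a]]
     | v # vs \<Rightarrow> if last v < a then (a # v) # vs else [a] # v # vs)"

lemma concat_pivot_blocks [simp]: "concat (pivot_blocks w) = w"
  by (induction w) (auto split: list.splits)

lemma min_last_pivot_blocks: "v \<in> set (pivot_blocks w) \<Longrightarrow> min_last v"
proof (induction w arbitrary: v)
  case (Cons a w)
  then show ?case
    by (auto simp: min_last_def split: list.splits if_splits)
qed simp

abbreviation sorted_by :: "('a \<Rightarrow> nat) \<Rightarrow> 'a list \<Rightarrow> bool" where
  "sorted_by f \<equiv> sorted_wrt (\<lambda>a b. f a < f b)"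

lemma sorted_by_iff: "sorted_by f xs \<longleftrightarrow> sorted (map f xs) \<and> distinct (map f xs)"
  using strict_sorted_iff[of "map f xs"] by (simp add: sorted_wrt_map)

text \<open>Pivots are minima of shrinking suffixes, hence increase; distinctness of the letters
  makes the increase strict.\<close>

lemma sorted_pivot_blocks: "distinct w \<Longrightarrow> sorted_by last (pivot_blocks w)"
proof (induction w)
  case (Cons a w)
  show ?case
  proof (cases "pivot_blocks w")
    case (Cons v vs)
    have "v \<noteq> []" using min_last_pivot_blocks[of v w] Cons by (auto simp: min_last_def)
    moreover have "set v \<subseteq> set w"
      using concat_pivot_blocks[of w] Cons by (metis concat.simps(2) set_append Un_upper1)
    ultimately have "last v \<noteq> a" using Cons.prems by (metis distinct.simps(2) last_in_set subsetD)
    then show ?thesis using Cons.IH Cons.prems Cons \<open>v \<noteq> []\<close> by fastforce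
  qed simp
qed simp

text \<open>Read from the right: the last letter of \<open>v\<close> lies below the next pivot and
  opens a block of its own; the other letters of \<open>v\<close> exceed it and join that
  block.\<close>

lemma pivot_blocks_append:
  assumes "min_last v" "\<forall>u\<in>set (pivot_blocks w). last v < last u"
  shows "pivot_blocks (v @ w) = v # pivot_blocks w"
  using assms
proof (induction v)
  case (Cons a v)
  show ?case
  proof (cases "v = []")
    case True
    then show ?thesis using Cons.prems by (auto split: list.splits)
  next
    case False
    then have "min_last v" "last v < a" using Cons.prems by (auto simp: min_last_def)
    then show ?thesis using Cons False by simp
  qed
qed (simp add: min_last_def)

text \<open>Uniqueness of the factorisation: any list of blocks with the shape and order of a pivot
  factorisation is the one of its concatenation.\<close>

lemma pivot_blocks_concat:
  assumes "\<forall>v\<in>set vs. min_last v" "sorted_by last vs"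
  shows "pivot_blocks (concat vs) = vs"
  using assms by (induction vs) (simp_all add: pivot_blocks_append)

lemma mset_concat_cong: "mset xs = mset ys \<Longrightarrow> mset (concat xs) = mset (concat ys)"
  by (metis mset_concat mset_map sum_mset_sum_list)

section \<open>Unshuffles of a strictly sorted list\<close>

lemma sorted_by_mset_unique:
  assumes "sorted_by f xs" "sorted_by f ys" "mset xs = mset ys"
  shows "xs = ys"
  using assms
proof (induction xs arbitrary: ys)
  case (Cons x xs)
  then obtain y zs where ys: "ys = y # zs" by (cases ys) auto
  have s: "set (x # xs) = set ys" using Cons.prems(3) by (metis mset_eq_setD)
  then have "x \<in> set ys" "y \<in> set (x # xs)" using ys by auto
  then have "x = y" using Cons.prems(1,2) ys by fastforce
  then show ?case using Cons ys by simp
qed simp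

text \<open>The first entry \<open>a\<close> has the least value of \<open>f\<close>, so in sorted
  parts it heads whichever part contains it; induction handles what follows.\<close>

lemma set_splits:
  assumes "sorted_by f w"
  shows "(x, y) \<in> set (splits w) \<longleftrightarrow> mset x + mset y = mset w \<and> sorted_by f x \<and> sorted_by f y"
  using assms
proof (induction w arbitrary: x y)
  case (Cons a w)
  have "(x, y) \<in> set (splits (a # w)) \<longleftrightarrow>
      (\<exists>x'. x = a # x' \<and> (x', y) \<in> set (splits w)) \<or> (\<exists>y'. y = a # y' \<and> (x, y') \<in> set (splits w))"
    by force
  also have "\<dots> \<longleftrightarrow> mset x + mset y = mset (a # w) \<and> sorted_by f x \<and> sorted_by f y" (is "?L \<longleftrightarrow> ?R")
  proof
    assume ?L
    then show ?R
    proof (elim disjE exE conjE)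
      fix x' assume *: "x = a # x'" "(x', y) \<in> set (splits w)"
      then have m: "mset x' + mset y = mset w" "sorted_by f x'" "sorted_by f y"
        using Cons by auto
      have "set x' \<subseteq> set w" using m(1) by (metis mset_subset_eq_add_left set_mset_mono set_mset_mset)
      then show ?R using * m Cons.prems by auto
    next
      fix y' assume *: "y = a # y'" "(x, y') \<in> set (splits w)"
      then have m: "mset x + mset y' = mset w" "sorted_by f x" "sorted_by f y'"
        using Cons by auto
      have "set y' \<subseteq> set w" using m(1) by (metis mset_subset_eq_add_right set_mset_mono set_mset_mset)
      then show ?R using * m Cons.prems by auto
    qed
  next
    assume R: ?R
    then have un: "set x \<union> set y = set (a # w)" by (metis set_mset_mset set_mset_union)
    have le: "f a \<le> f b" if "b \<in> set x \<union> set y" for b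
      using that Cons.prems unfolding un by fastforce
    from un consider "a \<in> set x" | "a \<in> set y" by auto
    then show ?L
    proof cases
      case 1
      then obtain b x' where x: "x = b # x'" by (cases x) auto
      then have "b = a" using 1 R le[of b] by fastforce
      then show ?thesis using R x Cons by auto
    next
      case 2
      then obtain b y' where y: "y = b # y'" by (cases y) auto
      then have "b = a" using 2 R le[of b] by fastforce
      then show ?thesis using R y Cons by auto
    qed
  qed
  finally show ?case .
qed auto

lemma distinct_concat_map:
  assumes "distinct xs" "\<And>x. x \<in> set xs \<Longrightarrow> distinct (f x)"
    "\<And>x y. x \<in> set xs \<Longrightarrow> y \<in> set xs \<Longrightarrow> x \<noteq> y \<Longrightarrow> set (f x) \<inter> set (f y) = {}"
  shows "distinct (concat (map f xs))"
  using assms by (induction xs) (simp_all, blast)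

lemma distinct_splits: "distinct w \<Longrightarrow> distinct (splits w)"
proof (induction w)
  case (Cons a w)
  have sub: "(x, y) \<in> set (splits v) \<Longrightarrow> set x \<subseteq> set v" for x y :: "'a list" and v
    by (induction v arbitrary: x y) fastforce+
  show ?case using Cons by (auto simp: distinct_map inj_on_def dest: sub)
qed simp

lemma set_unshufflings:
  assumes "sorted_by f w"
  shows "xss \<in> set (unshufflings wt q w) \<longleftrightarrow>
    map wt xss = q \<and> mset (concat xss) = mset w \<and> (\<forall>xs\<in>set xss. sorted_by f xs)"
  using assms
proof (induction q arbitrary: w xss)
  case (Cons m q)
  have "xss \<in> set (unshufflings wt (m # q) w) \<longleftrightarrow>
    (\<exists>x y yss. xss = x # yss \<and> (x, y) \<in> set (splits w) \<and> wt x = m \<and> yss \<in> set (unshufflings wt q y))"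
    by (auto split: if_splits)
  also have "\<dots> \<longleftrightarrow> (\<exists>x y yss. xss = x # yss \<and> mset x + mset y = mset w \<and> sorted_by f x \<and>
     sorted_by f y \<and> wt x = m \<and>
     map wt yss = q \<and> mset (concat yss) = mset y \<and> (\<forall>xs\<in>set yss. sorted_by f xs))"
    by (intro iff_exI) (simp add: set_splits[OF Cons.prems] Cons.IH cong: conj_cong)
  also have "\<dots> \<longleftrightarrow> (\<exists>x yss. xss = x # yss \<and> mset x + mset (concat yss) = mset w \<and> sorted_by f x \<and>
     wt x = m \<and> map wt yss = q \<and> (\<forall>xs\<in>set yss. sorted_by f xs))" (is "?L \<longleftrightarrow> ?R")
  proof -
    \<comment> \<open>The recursion needs the remainder as a sorted list, while the pieces only
      determine its multiset. Sorting supplies it, and the order is strict because \<open>f\<close>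
      is injective on the entries of \<open>w\<close>.\<close>
    have ex: "\<exists>y. mset z = mset y \<and> sorted_by f y" if "mset x + mset z = mset w" for x z
    proof -
      have "distinct (map f w)" using Cons.prems sorted_by_iff by blast
      have "set z \<subseteq> set w" using that by (metis mset_subset_eq_add_right set_mset_mono set_mset_mset)
      have "distinct (x @ z)"
        using that \<open>distinct (map f w)\<close> mset_eq_imp_distinct_iff[of "x @ z" w]
        by (simp add: distinct_map)
      then have "distinct (map f (sort_key f z))"
        using \<open>distinct (map f w)\<close> \<open>set z \<subseteq> set w\<close> 
        by (auto simp: distinct_map intro: inj_on_subset)
      then have "sorted_by f (sort_key f z)"
        using sorted_by_iff sorted_sort_key by blast
      then show ?thesis by (metis mset_sort)
    qed
    show ?thesis
    proof
      show "?L \<Longrightarrow> ?R" by auto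
      assume ?R
      then obtain x yss where *: "xss = x # yss" "mset x + mset (concat yss) = mset w"
        "sorted_by f x" "wt x = m" "map wt yss = q" "\<forall>xs\<in>set yss. sorted_by f xs" by blast
      from ex[OF *(2)] obtain y where "mset (concat yss) = mset y" "sorted_by f y" by blast
      with * show ?L by (intro exI[of _ x] exI[of _ y] exI[of _ yss]) simp
    qed
  qed
  also have "\<dots> \<longleftrightarrow> map wt xss = m # q \<and> mset (concat xss) = mset w \<and> (\<forall>xs\<in>set xss. sorted_by f xs)"
    by (cases xss) auto
  finally show ?case .
qed auto

text \<open>The first part of a split determines its complement, so different splits have different
  first parts and yield disjoint lists of unshuffles. Sums over unshuffles thereby become sums over
  sets.\<close>

lemma distinct_unshufflings:
  assumes "sorted_by f w"
  shows "distinct (unshufflings wt q w)"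
  using assms
proof (induction q arbitrary: w)
  case (Cons m q)
  have "distinct w" using Cons.prems by (induction w) auto
  have "x = x' \<Longrightarrow> y = y'" if "(x, y) \<in> set (splits w)" "(x', y') \<in> set (splits w)" for x y x' y'
    using that sorted_by_mset_unique[of f y y'] by (simp add: set_splits[OF Cons.prems])
     (metis add_left_imp_eq)
  then show ?case using distinct_splits[OF \<open>distinct w\<close>] Cons
    unfolding unshufflings.simps
    by (intro distinct_concat_map)
      (auto simp: distinct_map set_splits[OF Cons.prems] split: if_splits)
qed simp

section \<open>Segments of a word and distributions of its blocks\<close>

fun segs :: "nat list \<Rightarrow> 'a list \<Rightarrow> 'a list list" where
  "segs [] u = []"
| "segs (m # q) u = take m u # segs q (drop m u)"

lemma map_length_segs: "length u = sum_list q \<Longrightarrow> map length (segs q u) = q"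
  by (induction q arbitrary: u) auto

lemma concat_segs: "length u = sum_list q \<Longrightarrow> concat (segs q u) = u"
  by (induction q arbitrary: u) auto

lemma segs_concat: "segs (map length xss) (concat xss) = xss"
  by (induction xss) auto

lemma distinct_segs: "distinct u \<Longrightarrow> xs \<in> set (segs q u) \<Longrightarrow> distinct xs"
  by (induction q arbitrary: u) (auto intro: distinct_take distinct_drop)

definition seg_blocks :: "nat list \<Rightarrow> nat list \<Rightarrow> nat list list" where
  "seg_blocks q u = concat (map pivot_blocks (segs q u))"

lemma min_last_seg_blocks: "v \<in> set (seg_blocks q u) \<Longrightarrow> min_last v"
  by (auto simp: seg_blocks_def min_last_pivot_blocks)

lemma concat_concat: "concat (concat xss) = concat (map concat xss)"
  by (induction xss) auto

lemma concat_seg_blocks: "length u = sum_list q \<Longrightarrow> concat (seg_blocks q u) = u"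
  by (simp add: seg_blocks_def concat_concat o_def concat_segs)

text \<open>Equality of multisets of blocks says that \<open>u\<close> arises from \<open>w\<close> by distributing the blocks of \<open>w\<close>
  among the segments: within a segment their order is forced.\<close>

definition fibre :: "nat list \<Rightarrow> nat list \<Rightarrow> nat list set" where
  "fibre q w = {u. mset u = mset w \<and> mset (seg_blocks q u) = mset (pivot_blocks w)}"

text \<open>In each segment the distributed blocks keep their increasing order, so they are the
  pivot factorisation of that segment. Hence the distribution can be read off the resulting
  word.\<close>

lemma map_pivot_blocks_segs:
  assumes "distinct w" "xss \<in> set (unshufflings (length \<circ> concat) q (pivot_blocks w))"
  shows "map pivot_blocks (segs q (concat (concat xss))) = xss"
proof -
  have *: "map (length \<circ> concat) xss = q" "mset (concat xss) = mset (pivot_blocks w)"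
    "\<forall>xs\<in>set xss. sorted_by last xs"
    using assms set_unshufflings[OF sorted_pivot_blocks] by blast+
  have "segs q (concat (concat xss)) = map concat xss"
    using segs_concat[of "map concat xss"] *(1) by (simp add: concat_concat o_def)
  moreover have "set (concat xss) = set (pivot_blocks w)" using *(2) by (metis set_mset_mset)
  then have "pivot_blocks (concat xs) = xs" if "xs \<in> set xss" for xs
    using that *(3) by (intro pivot_blocks_concat) (auto intro!: min_last_pivot_blocks[of _ w])
  ultimately show ?thesis by (simp add: map_idI)
qed

text \<open>Concatenating all blocks is a bijection from the distributions onto the fibre; its
  inverse cuts a word into segments and factors each at its own pivots.\<close>

lemma sum_unshufflings_pivot_blocks:
  fixes G :: "nat list list \<Rightarrow> 'r::comm_ring_1"
  assumes "distinct w" "length w = sum_list q"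
  shows "(\<Sum>xss\<leftarrow>unshufflings (length \<circ> concat) q (pivot_blocks w). G (concat xss)) =
    (\<Sum>u\<in>fibre q w. G (seg_blocks q u))"
proof -
  note S = sorted_pivot_blocks[OF assms(1)]
  have "(\<Sum>xss\<leftarrow>unshufflings (length \<circ> concat) q (pivot_blocks w). G (concat xss)) =
    (\<Sum>xss\<in>set (unshufflings (length \<circ> concat) q (pivot_blocks w)). G (concat xss))"
    by (rule sum_list_distinct_conv_sum_set[OF distinct_unshufflings[OF S]])
  also have "\<dots> = (\<Sum>u\<in>fibre q w. G (seg_blocks q u))"
  proof (rule sum.reindex_bij_witness[of _ "\<lambda>u. map pivot_blocks (segs q u)" "\<lambda>xss. concat (concat xss)"])
    fix xss assume x: "xss \<in> set (unshufflings (length \<circ> concat) q (pivot_blocks w))"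
    note e = map_pivot_blocks_segs[OF assms(1) x]
    show "map pivot_blocks (segs q (concat (concat xss))) = xss" by (fact e)
    have *: "mset (concat xss) = mset (pivot_blocks w)" using x set_unshufflings[OF S] by blast
    have "mset (concat (concat xss)) = mset w"
      using mset_concat_cong[OF *] by simp
    then show "concat (concat xss) \<in> fibre q w" using * e by (simp add: fibre_def seg_blocks_def)
    show "G (seg_blocks q (concat (concat xss))) = G (concat xss)" by (simp add: e seg_blocks_def)
  next
    fix u assume u: "u \<in> fibre q w"
    then have "length u = sum_list q" "distinct u"
      using assms by (auto simp: fibre_def) (metis size_mset, metis mset_eq_imp_distinct_iff)
    then show "concat (concat (map pivot_blocks (segs q u))) = u"
      by (simp add: concat_concat o_def concat_segs)
    have "map (length \<circ> concat) (map pivot_blocks (segs q u)) = q"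
      using map_length_segs[OF \<open>length u = sum_list q\<close>] by (simp add: o_def)
    moreover have "mset (concat (map pivot_blocks (segs q u))) = mset (pivot_blocks w)"
      using u by (simp add: fibre_def seg_blocks_def)
    ultimately show "map pivot_blocks (segs q u) \<in> set (unshufflings (length \<circ> concat) q (pivot_blocks w))"
      using distinct_segs[OF \<open>distinct u\<close>] unfolding set_unshufflings[OF S]
      by (auto simp: sorted_pivot_blocks)
  qed
  finally show ?thesis .
qed

text \<open>A word determines its multiset of segmentwise blocks, and sorting these by last letter
  recovers the pivot factorisation.\<close>

lemma fibre_disjoint:
  assumes "distinct w" "distinct w'" "u \<in> fibre q w" "u \<in> fibre q w'"
  shows "w = w'"
proof -
  have "pivot_blocks w = pivot_blocks w'"
    using assms by (intro sorted_by_mset_unique[of last]) (auto simp: fibre_def sorted_pivot_blocks)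
  then show ?thesis by (metis concat_pivot_blocks)
qed

text \<open>This lifts a distribution of block lengths to a distribution of the blocks
  themselves.\<close>

lemma image_mset_eq_mset_concat:
  assumes "image_mset f M = mset (concat rs)"
  shows "\<exists>Ms. sum_list Ms = M \<and> map (image_mset f) Ms = map mset rs"
  using assms
proof (induction rs arbitrary: M)
  case (Cons r rs)
  then obtain A B where "M = A + B" "image_mset f A = mset r" "image_mset f B = mset (concat rs)"
    by (auto dest!: image_mset_eq_plusD)
  with Cons.IH[of B] obtain Ms where "sum_list Ms = B" "map (image_mset f) Ms = map mset rs" by blast
  then show ?case using \<open>M = A + B\<close> \<open>image_mset f A = mset r\<close>
    by (intro exI[of _ "A # Ms"]) auto
qed simp

text \<open>From a word in the fibre, the block lengths inside the segments give the required
  compositions. Conversely, compositions of the segment lengths that rearrange the block lengths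
  prescribe a distribution of the blocks, and sorting them within each segment gives a word in the
  fibre.\<close>

lemma fibre_nonempty_iff:
  assumes "distinct w" "q \<in> compositions (length w)"
  shows "fibre q w \<noteq> {} \<longleftrightarrow> weak_refines (mset (map length (pivot_blocks w))) q"
proof
  assume "fibre q w \<noteq> {}"
  then obtain u where u: "mset u = mset w" "mset (seg_blocks q u) = mset (pivot_blocks w)"
    by (auto simp: fibre_def)
  then have len: "length u = sum_list q" using assms by (auto simp: compositions_def dest: mset_eq_length)
  define rs where "rs = map (map length \<circ> pivot_blocks) (segs q u)"
  have "length rs = length q" using arg_cong[OF map_length_segs[OF len], of length] by (simp add: rs_def)
  moreover have "rs ! i \<in> compositions (q ! i)" if "i < length q" for i
  proof -
    have i: "i < length (segs q u)" using that \<open>length rs = length q\<close> by (simp add: rs_def)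
    have "sum_list (map length vs) = length (concat vs)" for vs :: "nat list list"
      by (simp add: length_concat)
    then have "sum_list (rs ! i) = length (segs q u ! i)" using i by (simp add: rs_def)
    also have "\<dots> = q ! i" using map_length_segs[OF len] i by (metis nth_map)
    finally show ?thesis using i min_last_pivot_blocks[of _ "segs q u ! i"]
      by (auto simp: rs_def compositions_def min_last_def)
  qed
  moreover have "concat rs = map length (seg_blocks q u)"
    by (simp add: rs_def seg_blocks_def map_concat)
  then have "mset (concat rs) = mset (map length (pivot_blocks w))" using u(2) by simp
  ultimately show "weak_refines (mset (map length (pivot_blocks w))) q"
    unfolding weak_refines_def by blast
next
  assume "weak_refines (mset (map length (pivot_blocks w))) q"
  then obtain rs where rs: "length rs = length q" "\<forall>i<length q. rs ! i \<in> compositions (q ! i)"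
    "image_mset length (mset (pivot_blocks w)) = mset (concat rs)"
    by (auto simp: weak_refines_def)
  obtain Ms where Ms: "sum_list Ms = mset (pivot_blocks w)" "map (image_mset length) Ms = map mset rs"
    using image_mset_eq_mset_concat[OF rs(3)] by blast
  \<comment> \<open>The blocks assigned to a segment come as a multiset; any listing of it will do
    before sorting.\<close>
  define xss where "xss = map (\<lambda>M. sort_key last (SOME xs. mset xs = M)) Ms"
  have mset_some: "mset (SOME xs. mset xs = M) = M" for M :: "nat list multiset"
    by (rule someI_ex) (rule ex_mset)
  have "mset (concat xss) = sum_list Ms"
    by (simp add: mset_concat xss_def mset_some o_def)
  then have c: "mset (concat xss) = mset (pivot_blocks w)" using Ms by simp
  have len: "length Ms = length rs" using Ms(2) by (metis length_map)
  have "map (length \<circ> concat) xss = q"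
  proof (rule nth_equalityI)
    show "length (map (length \<circ> concat) xss) = length q" using len rs by (simp add: xss_def)
    fix i assume "i < length (map (length \<circ> concat) xss)"
    then have i: "i < length Ms" "i < length rs" "i < length q" using len rs by (auto simp: xss_def)
    have "length (concat (xss ! i)) = sum_mset (image_mset length (mset (xss ! i)))"
      by (simp add: length_concat sum_mset_sum_list flip: mset_map)
    also have "mset (xss ! i) = Ms ! i" using i by (simp add: xss_def mset_some)
    also have "image_mset length (Ms ! i) = mset (rs ! i)" using Ms(2) i by (metis nth_map)
    also have "sum_mset (mset (rs ! i)) = q ! i" using rs(2) i by (simp add: compositions_def sum_mset_sum_list)
    finally show "map (length \<circ> concat) xss ! i = q ! i" using i by (simp add: xss_def)
  qed
  moreover have "sorted_by last xs" if "xs \<in> set xss" for xs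
  proof -
    \<comment> \<open>Different blocks end in different letters, so sorting by last letter gives a
      strict order.\<close>
    have "distinct (map last (pivot_blocks w))"
      using sorted_pivot_blocks[OF assms(1)] sorted_by_iff by blast
    moreover have "mset (map last (concat xss)) = mset (map last (pivot_blocks w))"
      unfolding mset_map c ..
    ultimately have "distinct (map last (concat xss))"
      using mset_eq_imp_distinct_iff by blast
    moreover obtain ys zs where "xss = ys @ xs # zs" using split_list[OF \<open>xs \<in> set xss\<close>] by blast
    ultimately have "distinct (map last xs)" by simp
    moreover have "sorted (map last xs)" using that by (auto simp: xss_def)
    ultimately show ?thesis using sorted_by_iff by blast
  qed
  ultimately have "xss \<in> set (unshufflings (length \<circ> concat) q (pivot_blocks w))"
    unfolding set_unshufflings[OF sorted_pivot_blocks[OF assms(1)]] using c by blast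
  from map_pivot_blocks_segs[OF assms(1) this]
  have "concat (concat xss) \<in> fibre q w"
    using c mset_concat_cong[OF c] by (simp add: fibre_def seg_blocks_def)
  then show "fibre q w \<noteq> {}" by blast
qed

section \<open>Unitriangular changes of basis\<close>

text \<open>Vectors are given through coordinates \<open>X v i\<close>. In the uses below
  \<open>i\<close> runs over all functions \<open>g\<close> on words, so an element is represented
  by its pairings with all functionals.\<close>

definition lin_indep :: "'s set \<Rightarrow> ('s \<Rightarrow> 'i \<Rightarrow> 'r::comm_ring_1) \<Rightarrow> bool" where
  "lin_indep S X \<longleftrightarrow> (\<forall>c. (\<forall>i. (\<Sum>v\<in>S. c v * X v i) = 0) \<longrightarrow> (\<forall>v\<in>S. c v = 0))"

lemma lin_indepD: "lin_indep S X \<Longrightarrow> (\<And>i. (\<Sum>v\<in>S. c v * X v i) = 0) \<Longrightarrow> v \<in> S \<Longrightarrow> c v = 0"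
  by (simp add: lin_indep_def)

definition unitriangular :: "'s set \<Rightarrow> ('s \<Rightarrow> nat) \<Rightarrow> ('s \<Rightarrow> 's \<Rightarrow> 'r::comm_ring_1) \<Rightarrow> bool" where
  "unitriangular S K b \<longleftrightarrow>
     (\<forall>w\<in>S. b w w = 1 \<and> (\<forall>v\<in>S. v \<noteq> w \<longrightarrow> K v \<le> K w \<longrightarrow> b w v = 0))"

text \<open>In a nontrivial relation take \<open>w0\<close> of least key with nonzero coefficient.
  Rewritten in terms of \<open>Y\<close>, the relation has coefficient \<open>c w0\<close> at
  \<open>w0\<close>, which must vanish. The diagonal entries are 1, so no division occurs.\<close>

lemma lin_indep_unitriangular:
  assumes "finite S" "unitriangular S K b" "lin_indep S Y"
    and X: "\<forall>w\<in>S. \<forall>i. X w i = (\<Sum>v\<in>S. b w v * Y v i)"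
  shows "lin_indep S X"
  unfolding lin_indep_def
proof (rule allI, rule impI, rule ccontr)
  fix c assume c: "\<forall>i. (\<Sum>v\<in>S. c v * X v i) = 0" and "\<not> (\<forall>v\<in>S. c v = 0)"
  then have "\<exists>w. w \<in> S \<and> c w \<noteq> 0" by blast
  then obtain w0 where w0: "w0 \<in> S" "c w0 \<noteq> 0" "\<And>w. w \<in> S \<Longrightarrow> c w \<noteq> 0 \<Longrightarrow> K w0 \<le> K w"
    using ex_has_least_nat[of "\<lambda>w. w \<in> S \<and> c w \<noteq> 0" _ K] by blast
  have "(\<Sum>v\<in>S. (\<Sum>w\<in>S. c w * b w v) * Y v i) = 0" for i
  proof -
    have "(\<Sum>v\<in>S. (\<Sum>w\<in>S. c w * b w v) * Y v i) = (\<Sum>v\<in>S. \<Sum>w\<in>S. c w * (b w v * Y v i))"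
      by (simp add: sum_distrib_right mult.assoc)
    also have "\<dots> = (\<Sum>w\<in>S. \<Sum>v\<in>S. c w * (b w v * Y v i))" by (rule sum.swap)
    also have "\<dots> = (\<Sum>w\<in>S. c w * X w i)" by (simp add: X sum_distrib_left)
    finally show ?thesis using c by simp
  qed
  then have "(\<Sum>w\<in>S. c w * b w w0) = 0"
    using lin_indepD[OF assms(3), of "\<lambda>v. \<Sum>w\<in>S. c w * b w v"] w0(1) by blast
  moreover have "c w * b w w0 = (if w = w0 then c w0 else 0)" if "w \<in> S" for w
    using w0 that assms(2) by (cases "c w = 0") (auto simp: unitriangular_def)
  then have "(\<Sum>w\<in>S. c w * b w w0) = (\<Sum>w\<in>S. if w = w0 then c w0 else 0)" by (intro sum.cong) auto
  then have "(\<Sum>w\<in>S. c w * b w w0) = c w0" using assms(1) w0 by simp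
  ultimately show False using w0 by simp
qed

text \<open>Back substitution: \<open>Y w\<close> is \<open>X w\<close> minus multiples of
  \<open>Y v\<close> for \<open>v\<close> of strictly larger key, and these are already expressed
  through \<open>X\<close>.\<close>

lemma unitriangular_inverse:
  fixes b :: "'s \<Rightarrow> 's \<Rightarrow> 'r::comm_ring_1"
  assumes "finite S" "unitriangular S K b"
    and X: "\<forall>w\<in>S. \<forall>i. X w i = (\<Sum>v\<in>S. b w v * Y v i)"
  shows "\<exists>b'. unitriangular S K b' \<and> (\<forall>w\<in>S. \<forall>i. Y w i = (\<Sum>v\<in>S. b' w v * X v i))"
proof -
  have "\<exists>e. e w = 1 \<and> (\<forall>v\<in>S. v \<noteq> w \<longrightarrow> K v \<le> K w \<longrightarrow> e v = 0) \<and> (\<forall>i. Y w i = (\<Sum>v\<in>S. e v * X v i))"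
    (is "\<exists>e. ?P w e") if "w \<in> S" for w
    using that
  \<comment> \<open>The distance from the maximal key decreases as the key grows, so larger keys are
    treated first.\<close>
  proof (induction "Max (K ` S) - K w" arbitrary: w rule: less_induct)
    case less
    let ?V = "{v \<in> S. K w < K v}"
    have "\<forall>v\<in>?V. \<exists>e. ?P v e"
    proof (rule ballI, rule less.hyps)
      fix v assume that: "v \<in> ?V"
      have "K v \<le> Max (K ` S)" using that assms(1) by (intro Max_ge) auto
      then show "Max (K ` S) - K v < Max (K ` S) - K w" using that by auto
    qed simp
    then obtain e where e: "\<forall>v\<in>?V. ?P v (e v)" by (rule bchoice[THEN exE])
    \<comment> \<open>The row of the inverse: the unit row of \<open>w\<close> minus the rows
      \<open>e v\<close> weighted by the entries \<open>b w v\<close>.\<close>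
    define f where "f u = (if u = w then 1 else 0) - (\<Sum>v\<in>?V. b w v * e v u)" for u
    have f: "f u = (if u = w then 1 else 0)" if "u \<in> S" "K u \<le> K w" for u
    proof -
      have "e v u = 0" if "v \<in> ?V" for v
        using e that \<open>u \<in> S\<close> \<open>K u \<le> K w\<close> by force
      then show ?thesis by (simp add: f_def)
    qed
    have "Y w i = (\<Sum>u\<in>S. f u * X u i)" for i
    proof -
      have "X w i = Y w i + (\<Sum>v\<in>S - {w}. b w v * Y v i)"
        using X assms(1,2) less.prems
        by (simp add: sum.remove unitriangular_def)
      also have "(\<Sum>v\<in>S - {w}. b w v * Y v i) = (\<Sum>v\<in>?V. b w v * Y v i)"
      proof (rule sum.mono_neutral_right)
        show "\<forall>v\<in>S - {w} - ?V. b w v * Y v i = 0"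
          using assms(2) less.prems by (auto simp: unitriangular_def not_less)
      qed (use assms(1) in auto)
      also have "\<dots> = (\<Sum>v\<in>?V. \<Sum>u\<in>S. b w v * e v u * X u i)"
        using e by (intro sum.cong refl) (simp add: sum_distrib_left mult.assoc)
      also have "\<dots> = (\<Sum>u\<in>S. (\<Sum>v\<in>?V. b w v * e v u) * X u i)"
        by (subst sum.swap) (simp add: sum_distrib_right)
      finally have "Y w i = X w i - (\<Sum>u\<in>S. (\<Sum>v\<in>?V. b w v * e v u) * X u i)" by simp
      also have "X w i = (\<Sum>u\<in>S. (if u = w then 1 else 0) * X u i)"
        using assms(1) less.prems by (simp add: if_distrib[of "\<lambda>x. x * _"] cong: if_cong)
      finally show ?thesis by (simp add: f_def left_diff_distrib sum_subtractf)
    qed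
    then show ?case using f less.prems by (intro exI[of _ f]) auto
  qed
  then have "\<forall>w\<in>S. \<exists>e. ?P w e" by (intro ballI)
  then obtain b' where "\<forall>w\<in>S. ?P w (b' w)" by (rule bchoice[THEN exE])
  then show ?thesis by (intro exI[of _ b']) (auto simp: unitriangular_def)
qed

text \<open>Equal words in \<open>L\<close> are collected; the value at the indicator of
  \<open>v\<close> is the coefficient of \<open>v\<close>.\<close>

lemma ev_expand:
  fixes g :: "'a list \<Rightarrow> 'r::comm_ring_1"
  assumes "finite S" "\<And>c u. (c, u) \<in> set L \<Longrightarrow> u \<in> S"
  shows "ev L g = (\<Sum>v\<in>S. ev L (\<lambda>u. if u = v then 1 else 0) * g v)"
  using assms(2)
proof (induction L)
  case (Cons p L)
  obtain c u where p: "p = (c, u)" by force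
  have "u \<in> S" using Cons.prems[of c u] p by simp
  then have "(\<Sum>v\<in>S. (if u = v then of_int c else 0) * g v) = (of_int c :: 'r) * g u"
    using assms(1) by (simp add: if_distrib[of "\<lambda>x. x * _"] cong: if_cong)
  moreover have "ev (p # L) (\<lambda>u. if u = v then 1 else 0) =
      (if u = v then of_int c else 0) + ev L (\<lambda>u. if u = v then 1 else 0 :: 'r)" for v
    by (simp add: p)
  moreover have "ev L g = (\<Sum>v\<in>S. ev L (\<lambda>u. if u = v then 1 else 0) * g v)"
    using Cons.prems by (intro Cons.IH) auto
  ultimately show ?case by (simp add: p distrib_right sum.distrib)
qed simp

section \<open>Words on n letters and the basis theorem for unshuffles\<close>

definition words :: "nat \<Rightarrow> nat list set" where
  "words n = {w. distinct w \<and> set w = {1..n}}"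

lemma words_mset: "w \<in> words n \<Longrightarrow> mset u = mset w \<Longrightarrow> u \<in> words n"
  by (auto simp: words_def dest: mset_eq_imp_distinct_iff mset_eq_setD)

lemma length_words: "w \<in> words n \<Longrightarrow> length w = n"
  using distinct_card[of w] by (simp add: words_def)

lemma finite_words: "finite (words n)"
proof (rule finite_subset)
  show "words n \<subseteq> {w. set w \<subseteq> {1..n} \<and> length w = n}"
    using length_words by (auto simp: words_def)
qed (simp add: finite_lists_length_eq)

text \<open>The factorisation \<open>f\<close> is left open because it is used both for
  \<open>pivot_blocks\<close> and for \<open>seg_blocks q\<close>. The base \<open>Suc n\<close>
  exceeds every letter.\<close>

lemma ev_pbw_unitriangular:
  assumes "\<forall>w\<in>words n. concat (f w) = w" "\<forall>w\<in>words n. \<forall>v\<in>set (f w). min_last v"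
  shows "\<exists>b. unitriangular (words n) (key (Suc n)) b \<and>
    (\<forall>w\<in>words n. \<forall>g::nat list \<Rightarrow> 'r::comm_ring_1. ev (pbw (f w)) g = (\<Sum>v\<in>words n. b w v * g v))"
proof -
  let ?b = "\<lambda>w v. ev (pbw (f w)) (\<lambda>u. if u = v then 1 else 0 :: 'r)"
  have ex: "ev (pbw (f w)) g = (\<Sum>v\<in>words n. ?b w v * g v)" if w: "w \<in> words n" for w g
  proof (rule ev_expand[OF finite_words])
    fix c u assume "(c, u) \<in> set (pbw (f w))"
    then have "mset u = mset w" using mset_pbw assms(1) w by metis
    then show "u \<in> words n" by (rule words_mset[OF w])
  qed
  have "unitriangular (words n) (key (Suc n)) ?b"
    unfolding unitriangular_def
  proof (intro ballI conjI impI)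
    fix w assume w: "w \<in> words n"
    then have "\<forall>a\<in>set (concat (f w)). a < Suc n" using assms(1) by (auto simp: words_def)
    then obtain R where "pbw (f w) = (1, concat (f w)) # R"
      "\<forall>(c, u)\<in>set R. key (Suc n) (concat (f w)) < key (Suc n) u"
      using pbw_unitriangular[of "f w" "Suc n"] assms(2) w by blast
    then have R: "pbw (f w) = (1, w) # R" "\<forall>(c, u)\<in>set R. key (Suc n) w < key (Suc n) u"
      using assms(1) w by simp_all
    have 0: "ev R (\<lambda>u. if u = v then 1 else 0 :: 'r) = 0" if "key (Suc n) v \<le> key (Suc n) w" for v
    proof -
      have "ev R (\<lambda>u. if u = v then 1 else 0 :: 'r) = ev R (\<lambda>_. 0)"
        using R(2) that by (intro ev_cong) auto
      then show ?thesis by simp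
    qed
    then show "ev (pbw (f w)) (\<lambda>u. if u = w then 1 else 0 :: 'r) = 1"
      by (simp add: R(1))
    show "ev (pbw (f w)) (\<lambda>u. if u = v then 1 else 0 :: 'r) = 0"
      if "v \<noteq> w" "key (Suc n) v \<le> key (Suc n) w" for v
      using 0[OF that(2)] that(1) by (simp add: R(1))
  qed
  then show ?thesis using ex by blast
qed

text \<open>The map T evaluated at the word \<open>w\<close>, paired with the functional
  \<open>g\<close>.\<close>

definition unshuffle :: "nat list \<Rightarrow> nat list \<Rightarrow> (nat list \<Rightarrow> 'r::comm_ring_1) \<Rightarrow> 'r" where
  "unshuffle q w g = (\<Sum>xss\<leftarrow>unshufflings length q w. g (concat xss))"

definition pivot_words :: "nat \<Rightarrow> nat list \<Rightarrow> nat list set" where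
  "pivot_words n q = {w \<in> words n. weak_refines (mset (map length (pivot_blocks w))) q}"

text \<open>The elements T(P_w) are sums, over disjoint fibres, of members of one independent
  family, and they vanish unless \<open>w\<close> lies in \<open>pivot_words n q\<close>. Two
  unitriangular inversions pass from them to the elements T(w).\<close>

theorem unshuffle_basis:
  assumes "q \<in> compositions n"
  shows "lin_indep (pivot_words n q) (unshuffle q :: _ \<Rightarrow> _ \<Rightarrow> 'r::comm_ring_1)" (is ?indep)
    and "\<And>w. w \<in> words n \<Longrightarrow>
      \<exists>c. \<forall>g. (unshuffle q w g :: 'r) = (\<Sum>v\<in>pivot_words n q. c v * unshuffle q v g)" (is "PROP ?span")
proof -
  let ?S = "words n" and ?B = "pivot_words n q" and ?K = "key (Suc n)"
  \<comment> \<open>\<open>Q w\<close> is T(P_w), and \<open>?Z u\<close> is the product of brackets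
    for the segmentwise blocks of \<open>u\<close>.\<close>
  define Q :: "nat list \<Rightarrow> (nat list \<Rightarrow> 'r) \<Rightarrow> 'r" where
    "Q w g = ev (pbw (pivot_blocks w)) (\<lambda>u. unshuffle q u g)" for w g
  let ?Z = "\<lambda>u g. ev (pbw (seg_blocks q u)) g :: 'r"
  have q: "sum_list q = n" using assms by (simp add: compositions_def)
  have BS: "?B \<subseteq> ?S" by (auto simp: pivot_words_def)
  then have fin: "finite ?B" by (rule finite_subset[OF _ finite_words])
  have Q_fibre: "Q w g = (\<Sum>u\<in>fibre q w. ?Z u g)" if "w \<in> ?S" for w g
    unfolding Q_def unshuffle_def pbw_unshuffle
    using that q by (intro sum_unshufflings_pivot_blocks) (auto simp: words_def length_words[OF that])
  have fibre_S: "fibre q w \<subseteq> ?S" if "w \<in> ?S" for w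
    using words_mset[OF that] by (auto simp: fibre_def)
  have fibre_B: "fibre q w \<noteq> {} \<longleftrightarrow> w \<in> ?B" if "w \<in> ?S" for w
    using that fibre_nonempty_iff[of w q] assms length_words[OF that]
    by (auto simp: pivot_words_def words_def)
  have indep_Z: "lin_indep ?S ?Z"
  proof -
    have "\<forall>w\<in>?S. concat (seg_blocks q w) = w" "\<forall>w\<in>?S. \<forall>v\<in>set (seg_blocks q w). min_last v"
      using q min_last_seg_blocks by (auto simp: concat_seg_blocks length_words)
    then obtain b :: "nat list \<Rightarrow> nat list \<Rightarrow> 'r" where b: "unitriangular ?S ?K b"
      "\<forall>w\<in>?S. \<forall>g. ev (pbw (seg_blocks q w)) g = (\<Sum>v\<in>?S. b w v * g v)"
      using ev_pbw_unitriangular[of n "seg_blocks q", where 'r = 'r] by blast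
    \<comment> \<open>Indicator functions isolate the single coefficients.\<close>
    have "lin_indep ?S (\<lambda>v g. g v :: 'r)"
      unfolding lin_indep_def
    proof (intro allI impI ballI)
      fix c :: "nat list \<Rightarrow> 'r" and v assume "\<forall>g. (\<Sum>v\<in>?S. c v * g v) = 0" "v \<in> ?S"
      from this(1)[rule_format, of "\<lambda>u. if u = v then 1 else 0"]
      show "c v = 0" using \<open>v \<in> ?S\<close> finite_words
        by (simp add: if_distrib[of "\<lambda>x. _ * x"] cong: if_cong)
    qed
    then show ?thesis by (rule lin_indep_unitriangular[OF finite_words b(1) _ b(2)])
  qed
  have indep_Q: "lin_indep ?B Q"
    unfolding lin_indep_def
  proof (intro allI impI ballI)
    fix c v assume c: "\<forall>g. (\<Sum>w\<in>?B. c w * Q w g) = 0" and v: "v \<in> ?B"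
    \<comment> \<open>\<open>d u\<close> is the coefficient of \<open>?Z u\<close> once every
      \<open>Q w\<close> is written as the sum over its fibre. Disjointness of fibres leaves at most
      one nonzero summand.\<close>
    define d where "d u = (\<Sum>w\<in>?B. if u \<in> fibre q w then c w else 0)" for u
    have "(\<Sum>u\<in>?S. d u * ?Z u g) = 0" for g
    proof -
      have "c w * Q w g = (\<Sum>u\<in>?S. (if u \<in> fibre q w then c w else 0) * ?Z u g)" if "w \<in> ?B" for w
      proof -
        have "w \<in> ?S" using that BS by blast
        have "(\<Sum>u\<in>?S. (if u \<in> fibre q w then c w else 0) * ?Z u g)
            = (\<Sum>u\<in>?S. if u \<in> fibre q w then c w * ?Z u g else 0)"
          by (intro sum.cong) auto
        also have "\<dots> = (\<Sum>u\<in>?S \<inter> fibre q w. c w * ?Z u g)"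
          by (rule sum.inter_restrict[OF finite_words, symmetric])
        also have "?S \<inter> fibre q w = fibre q w" using fibre_S[OF \<open>w \<in> ?S\<close>] by blast
        finally show ?thesis using Q_fibre[OF \<open>w \<in> ?S\<close>] by (simp add: sum_distrib_left)
      qed
      then have "(\<Sum>w\<in>?B. c w * Q w g) = (\<Sum>w\<in>?B. \<Sum>u\<in>?S. (if u \<in> fibre q w then c w else 0) * ?Z u g)"
        by simp
      also have "\<dots> = (\<Sum>u\<in>?S. d u * ?Z u g)"
        by (subst sum.swap) (simp add: d_def sum_distrib_right)
      finally show ?thesis using c by simp
    qed
    then have d: "d u = 0" if "u \<in> ?S" for u using lin_indepD[OF indep_Z, of d] that by blast
    obtain u where u: "u \<in> fibre q v" using fibre_B[of v] v BS by blast
    have "d u = (\<Sum>w\<in>?B. if w = v then c w else 0)"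
      unfolding d_def
    proof (intro sum.cong refl)
      fix w assume "w \<in> ?B"
      then show "(if u \<in> fibre q w then c w else 0) = (if w = v then c w else 0)"
        using fibre_disjoint[of w v u q] u v BS by (auto simp: words_def)
    qed
    then have "d u = c v" using v fin by simp
    then show "c v = 0" using d[of u] u fibre_S v BS by auto
  qed
  have "\<forall>w\<in>?S. concat (pivot_blocks w) = w" "\<forall>w\<in>?S. \<forall>v\<in>set (pivot_blocks w). min_last v"
    using min_last_pivot_blocks by auto
  then obtain b :: "nat list \<Rightarrow> nat list \<Rightarrow> 'r" where b: "unitriangular ?S ?K b"
    "\<forall>w\<in>?S. \<forall>g. ev (pbw (pivot_blocks w)) g = (\<Sum>v\<in>?S. b w v * g v)"
    using ev_pbw_unitriangular[of n pivot_blocks, where 'r = 'r] by blast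
  \<comment> \<open>Applying T to the expansion of P_w makes \<open>Q\<close> unitriangular in the
    unshuffles, and this relation is inverted.\<close>
  obtain b' where b': "unitriangular ?S ?K b'"
    "\<forall>w\<in>?S. \<forall>g. unshuffle q w g = (\<Sum>v\<in>?S. b' w v * Q v g)"
    using unitriangular_inverse[OF finite_words b(1), of Q "unshuffle q"] b(2) unfolding Q_def by auto
  have E: "unshuffle q w g = (\<Sum>v\<in>?B. b' w v * Q v g)" if "w \<in> ?S" for w g
  proof -
    have "unshuffle q w g = (\<Sum>v\<in>?S. b' w v * Q v g)" using b'(2) that by blast
    also have "\<dots> = (\<Sum>v\<in>?B. b' w v * Q v g)"
    proof (rule sum.mono_neutral_right[OF finite_words BS], rule ballI)
      fix v assume "v \<in> ?S - ?B"
      then have "fibre q v = {}" using fibre_B by blast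
      then show "b' w v * Q v g = 0" using Q_fibre \<open>v \<in> ?S - ?B\<close> by simp
    qed
    finally show ?thesis .
  qed
  \<comment> \<open>As \<open>Q v\<close> vanishes outside \<open>?B\<close>, only the columns in
    \<open>?B\<close> matter, and the square block on \<open>?B\<close> is again
    unitriangular.\<close>
  have uB: "unitriangular ?B ?K b'" using b'(1) BS by (auto simp: unitriangular_def)
  have EB: "\<forall>w\<in>?B. \<forall>g. unshuffle q w g = (\<Sum>v\<in>?B. b' w v * Q v g)" using E BS by blast
  show ?indep by (rule lin_indep_unitriangular[OF fin uB indep_Q EB])
  \<comment> \<open>A second inversion, on \<open>?B\<close> alone, replaces each \<open>Q v\<close>
    by unshuffles of words in \<open>?B\<close>.\<close>
  obtain b2 where b2: "\<forall>w\<in>?B. \<forall>g. Q w g = (\<Sum>v\<in>?B. b2 w v * unshuffle q v g)"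
    using unitriangular_inverse[OF fin uB EB] by auto
  show "PROP ?span"
  proof -
    fix w assume w: "w \<in> ?S"
    have "unshuffle q w g = (\<Sum>u\<in>?B. (\<Sum>v\<in>?B. b' w v * b2 v u) * unshuffle q u g)" for g
    proof -
      have "unshuffle q w g = (\<Sum>v\<in>?B. \<Sum>u\<in>?B. b' w v * b2 v u * unshuffle q u g)"
        by (simp add: E[OF w] b2 sum_distrib_left mult.assoc)
      also have "\<dots> = (\<Sum>u\<in>?B. (\<Sum>v\<in>?B. b' w v * b2 v u) * unshuffle q u g)"
        by (subst sum.swap) (simp add: sum_distrib_right)
      finally show ?thesis .
    qed
    then show "\<exists>c. \<forall>g. (unshuffle q w g :: 'r) = (\<Sum>v\<in>?B. c v * unshuffle q v g)"
      by (intro exI[of _ "\<lambda>u. \<Sum>v\<in>?B. b' w v * b2 v u"]) simp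
  qed
qed

section \<open>From permutations to words\<close>

definition word :: "nat \<Rightarrow> perm \<Rightarrow> nat list" where
  "word n \<sigma> = map \<sigma> [1..<Suc n]"

lemma nth_word: "i < n \<Longrightarrow> word n \<sigma> ! i = \<sigma> (Suc i)"
  by (simp add: word_def del: upt_Suc)

lemma length_word [simp]: "length (word n \<sigma>) = n"
  by (simp add: word_def)

lemma word_eq_iff: "word n \<sigma> = word n \<tau> \<longleftrightarrow> (\<forall>i\<in>{1..n}. \<sigma> i = \<tau> i)"
  by (auto simp: word_def)

lemma word_comp: "map \<tau> (word n \<sigma>) = word n (\<tau> \<circ> \<sigma>)"
  by (simp add: word_def)

lemma bij_betw_word: "bij_betw (word n) (perms n) (words n)"
  unfolding bij_betw_def
proof
  show "inj_on (word n) (perms n)"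
  proof (rule inj_onI)
    fix \<sigma> \<tau> assume "\<sigma> \<in> perms n" "\<tau> \<in> perms n" "word n \<sigma> = word n \<tau>"
    then show "\<sigma> = \<tau>"
      unfolding word_eq_iff perms_def by (intro ext) (metis mem_Collect_eq permutes_not_in)
  qed
  show "word n ` perms n = words n"
  proof
    show "word n ` perms n \<subseteq> words n"
    proof
      fix u assume "u \<in> word n ` perms n"
      then obtain \<sigma> where \<sigma>: "u = word n \<sigma>" "\<sigma> permutes {1..n}" by (auto simp: perms_def)
      have "set u = \<sigma> ` {1..n}" by (auto simp: \<sigma> word_def)
      moreover have "distinct u" using permutes_inj_on[OF \<sigma>(2)] by (simp add: \<sigma> word_def distinct_map)
      ultimately show "u \<in> words n" using permutes_image[OF \<sigma>(2)] by (simp add: words_def)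
    qed
    show "words n \<subseteq> word n ` perms n"
    proof
      fix u assume u: "u \<in> words n"
      define \<sigma> where "\<sigma> i = (if i \<in> {1..n} then u ! (i - 1) else i)" for i
      have len: "length u = n" using length_words[OF u] .
      have w: "word n \<sigma> = u"
        by (rule nth_equalityI) (auto simp: len nth_word \<sigma>_def)
      have "bij_betw \<sigma> {1..n} {1..n}"
      proof -
        have "set [1..<Suc n] = {1..n}" by auto
        then show ?thesis using u w by (auto simp: bij_betw_def words_def word_def distinct_map simp del: upt_Suc)
      qed
      then have "\<sigma> permutes {1..n}" by (rule bij_imp_permutes) (auto simp: \<sigma>_def)
      then show "u \<in> word n ` perms n" using w by (auto simp: perms_def)
    qed
  qed
qed

section \<open>Products in the group ring\<close>

lemma finite_perms: "finite (perms n)"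
  by (simp add: perms_def finite_permutations)

text \<open>The right factor \<tau> and the product \<pi> determine the left factor, which is
  \<open>inv \<tau> \<circ> \<pi>\<close> because products run from left to right.\<close>

lemma gmul_eq:
  "gmul n a b \<pi> = (if \<pi> \<in> perms n then \<Sum>\<tau>\<in>perms n. a (inv \<tau> \<circ> \<pi>) * b \<tau> else 0)"
proof (cases "\<pi> \<in> perms n")
  case True
  have "(\<Sum>(\<sigma>, \<tau>) \<in> {(\<sigma>, \<tau>). \<sigma> \<in> perms n \<and> \<tau> \<in> perms n \<and> \<tau> \<circ> \<sigma> = \<pi>}. a \<sigma> * b \<tau>) =
    (\<Sum>\<tau>\<in>perms n. a (inv \<tau> \<circ> \<pi>) * b \<tau>)"
  proof (rule sum.reindex_bij_witness[of _ "\<lambda>\<tau>. (inv \<tau> \<circ> \<pi>, \<tau>)" snd])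
    fix p assume "p \<in> {(\<sigma>, \<tau>). \<sigma> \<in> perms n \<and> \<tau> \<in> perms n \<and> \<tau> \<circ> \<sigma> = \<pi>}"
    then obtain \<sigma> \<tau> where p: "p = (\<sigma>, \<tau>)" "\<tau> permutes {1..n}" "\<pi> = \<tau> \<circ> \<sigma>"
      by (auto simp: perms_def)
    then have "inv \<tau> \<circ> \<pi> = \<sigma>" using permutes_inv_o(2)[OF p(2)] by (simp add: o_assoc)
    then show "(inv (snd p) \<circ> \<pi>, snd p) = p" "snd p \<in> perms n"
      "a (inv (snd p) \<circ> \<pi>) * b (snd p) = (case p of (\<sigma>, \<tau>) \<Rightarrow> a \<sigma> * b \<tau>)"
      using p by (auto simp: perms_def)
  next
    fix \<tau> assume "\<tau> \<in> perms n"
    then have "\<tau> permutes {1..n}" "\<pi> permutes {1..n}" using True by (auto simp: perms_def)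
    moreover from this have "inv \<tau> \<circ> \<pi> permutes {1..n}" by (intro permutes_compose permutes_inv)
    ultimately show "(inv \<tau> \<circ> \<pi>, \<tau>) \<in> {(\<sigma>, \<tau>). \<sigma> \<in> perms n \<and> \<tau> \<in> perms n \<and> \<tau> \<circ> \<sigma> = \<pi>}"
      by (simp add: perms_def o_assoc permutes_inv_o)
  qed simp
  then show ?thesis using True by (simp add: gmul_def)
next
  case False
  have empty: "{(\<sigma>, \<tau>). \<sigma> \<in> perms n \<and> \<tau> \<in> perms n \<and> \<tau> \<circ> \<sigma> = \<pi>} = {}"
    using False by (auto simp: perms_def intro: permutes_compose)
  show ?thesis using False unfolding gmul_def empty by simp
qed

lemma gmul_delta:
  assumes "w \<in> perms n"
  shows "gmul n a (delta w) \<pi> = (if \<pi> \<in> perms n then a (inv w \<circ> \<pi>) else 0)"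
proof -
  have "(\<Sum>\<tau>\<in>perms n. a (inv \<tau> \<circ> \<pi>) * delta w \<tau>) = (\<Sum>\<tau>\<in>perms n. if \<tau> = w then a (inv w \<circ> \<pi>) else 0)"
    by (intro sum.cong) (auto simp: delta_def)
  then show ?thesis using assms finite_perms by (simp add: gmul_eq)
qed

lemma gmul_sum_delta: "gmul n a x \<pi> = (\<Sum>w\<in>perms n. x w * gmul n a (delta w) \<pi>)"
  by (auto simp: gmul_eq[of n a x] gmul_delta mult.commute intro!: sum.cong)

section \<open>Unshuffling as left multiplication by \<open>Xi\<close>\<close>

lemma splits_map: "splits (map f w) = map (\<lambda>(x, y). (map f x, map f y)) (splits w)"
  by (induction w) (auto simp: o_def case_prod_unfold)

lemma unshufflings_map: "unshufflings length q (map f w) = map (map (map f)) (unshufflings length q w)"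
proof (induction q arbitrary: w)
  case (Cons m q)
  show ?case unfolding unshufflings.simps splits_map map_concat map_map
    by (intro arg_cong[of _ _ concat] map_cong) (auto simp: Cons o_def)
qed simp

lemma unshuffle_map: "unshuffle q (map f w) g = unshuffle q w (\<lambda>u. g (map f u))"
  by (simp add: unshuffle_def unshufflings_map o_def map_concat)

lemma partial_sums_Cons: "partial_sums (m # q) = insert m ((+) m ` partial_sums q)"
proof (intro equalityI subsetI)
  fix x assume "x \<in> partial_sums (m # q)"
  then obtain j where j: "x = sum_list (take j (m # q))" "1 \<le> j" "j \<le> Suc (length q)"
    by (auto simp: partial_sums_def)
  then obtain i where "j = Suc i" by (cases j) auto
  show "x \<in> insert m ((+) m ` partial_sums q)"
  proof (cases "i = 0")
    case False
    then have "sum_list (take i q) \<in> partial_sums q"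
      using j \<open>j = Suc i\<close> by (auto simp: partial_sums_def)
    then show ?thesis using j \<open>j = Suc i\<close> by simp
  qed (use j \<open>j = Suc i\<close> in simp)
next
  fix x assume "x \<in> insert m ((+) m ` partial_sums q)"
  then consider "x = m" | j where "x = m + sum_list (take j q)" "1 \<le> j" "j \<le> length q"
    by (auto simp: partial_sums_def)
  then show "x \<in> partial_sums (m # q)"
  proof cases
    case 1
    then show ?thesis by (auto simp: partial_sums_def intro!: exI[of _ 1])
  next
    case 2
    then show ?thesis by (auto simp: partial_sums_def intro!: exI[of _ "Suc j"])
  qed
qed

text \<open>Two adjacent positions lie in one segment or meet at a boundary, and the boundaries are
  the partial sums. The list index \<open>j\<close> is position \<open>Suc j\<close> of the
  word.\<close>

lemma sorted_segs_iff:
  fixes u :: "nat list"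
  assumes "length u = sum_list q" "distinct u"
  shows "(\<forall>xs\<in>set (segs q u). sorted_wrt (<) xs) \<longleftrightarrow>
    (\<forall>j. Suc j < length u \<longrightarrow> u ! Suc j < u ! j \<longrightarrow> Suc j \<in> partial_sums q)"
  using assms
proof (induction q arbitrary: u)
  case (Cons m q)
  have nth: "sorted_wrt (<) (take m u) \<longleftrightarrow> (\<forall>j. Suc j < m \<longrightarrow> \<not> u ! Suc j < u ! j)"
  proof -
    have "u ! Suc j \<noteq> u ! j" if "Suc j < m" for j
      using that Cons.prems by (simp add: nth_eq_iff_index_eq)
    moreover have "sorted_wrt (<) (take m u) \<longleftrightarrow> (\<forall>j. Suc j < m \<longrightarrow> u ! j < u ! Suc j)"
      using Cons.prems(1) by (subst sorted_wrt_iff_nth_Suc_transp) auto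
    ultimately show ?thesis by (metis linorder_neqE less_asym)
  qed
  have "(\<forall>xs\<in>set (segs (m # q) u). sorted_wrt (<) xs) \<longleftrightarrow> (\<forall>j. Suc j < m \<longrightarrow> \<not> u ! Suc j < u ! j) \<and>
    (\<forall>j. Suc j < length u - m \<longrightarrow> u ! (m + Suc j) < u ! (m + j) \<longrightarrow> Suc j \<in> partial_sums q)"
    using Cons.IH[of "drop m u"] Cons.prems by (simp add: nth)
  also have "\<dots> \<longleftrightarrow> (\<forall>j. Suc j < length u \<longrightarrow> u ! Suc j < u ! j \<longrightarrow> Suc j \<in> partial_sums (m # q))"
    (is "?A \<and> ?B \<longleftrightarrow> ?C")
  proof
    assume AB: "?A \<and> ?B"
    show ?C
    proof (intro allI impI)
      fix j assume j: "Suc j < length u" "u ! Suc j < u ! j"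
      consider "Suc j < m" | "Suc j = m" | i where "j = m + i"
        by (metis less_antisym not_less_eq le_iff_add not_less)
      then show "Suc j \<in> partial_sums (m # q)"
      proof cases
        case 3
        then have "Suc i \<in> partial_sums q" using AB j by auto
        then show ?thesis using 3 unfolding partial_sums_Cons by force
      qed (use AB j in \<open>auto simp: partial_sums_Cons\<close>)
    qed
  next
    assume C: ?C
    show "?A \<and> ?B"
    proof (intro conjI allI impI)
      fix j assume "Suc j < m"
      \<comment> \<open>Every partial sum of \<open>m # q\<close> is at least
        \<open>m\<close>.\<close>
      then have "Suc j \<notin> partial_sums (m # q)" "Suc j < length u"
        using Cons.prems(1) by (auto simp: partial_sums_Cons)
      then show "\<not> u ! Suc j < u ! j" using C by blast
    next
      fix j assume "Suc j < length u - m" "u ! (m + Suc j) < u ! (m + j)"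
      then have "Suc (m + j) \<in> partial_sums (m # q)" using C by auto
      then show "Suc j \<in> partial_sums q" by (auto simp: partial_sums_Cons)
    qed
  qed
  finally show ?case .
qed auto

lemma descents_subset_iff:
  assumes "\<sigma> \<in> perms n" "sum_list q = n"
  shows "descents n \<sigma> \<subseteq> partial_sums q \<longleftrightarrow> (\<forall>xs\<in>set (segs q (word n \<sigma>)). sorted_wrt (<) xs)"
proof -
  have "distinct (word n \<sigma>)" using bij_betw_word[of n] assms by (auto simp: bij_betw_def words_def)
  then have "(\<forall>xs\<in>set (segs q (word n \<sigma>)). sorted_wrt (<) xs) \<longleftrightarrow>
      (\<forall>j. Suc j < n \<longrightarrow> \<sigma> (Suc (Suc j)) < \<sigma> (Suc j) \<longrightarrow> Suc j \<in> partial_sums q)"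
    using sorted_segs_iff[of "word n \<sigma>" q] assms by (simp add: nth_word)
  also have "\<dots> \<longleftrightarrow> descents n \<sigma> \<subseteq> partial_sums q"
  proof
    assume *: "\<forall>j. Suc j < n \<longrightarrow> \<sigma> (Suc (Suc j)) < \<sigma> (Suc j) \<longrightarrow> Suc j \<in> partial_sums q"
    show "descents n \<sigma> \<subseteq> partial_sums q"
    proof
      fix i assume "i \<in> descents n \<sigma>"
      then show "i \<in> partial_sums q" using *[rule_format, of "i - 1"] by (auto simp: descents_def)
    qed
  qed (auto simp: descents_def)
  finally show ?thesis by simp
qed

text \<open>The unshuffles of the identity word are the words increasing on every segment, each
  obtained once. These are the words whose descents are partial sums of \<open>q\<close>.\<close>

lemma unshuffle_upt_indicator:
  assumes "\<sigma> \<in> perms n" "sum_list q = n"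
  shows "unshuffle q [1..<Suc n] (\<lambda>u. if u = word n \<sigma> then 1 else 0) = Xi n q \<sigma>"
proof -
  let ?U = "unshufflings length q [1..<Suc n]" and ?s = "segs q (word n \<sigma>)"
  have S: "sorted_by (\<lambda>x. x) [1..<Suc n]" by (simp del: upt_Suc)
  have len: "length (word n \<sigma>) = sum_list q" using assms by simp
  have "concat xss = word n \<sigma> \<longleftrightarrow> xss = ?s" if "xss \<in> set ?U" for xss
    using that segs_concat[of xss] concat_segs[OF len] unfolding set_unshufflings[OF S] by auto
  then have "unshuffle q [1..<Suc n] (\<lambda>u. if u = word n \<sigma> then 1 else 0) =
      (\<Sum>xss\<in>set ?U. if xss = ?s then 1 else 0)"
    unfolding unshuffle_def sum_list_distinct_conv_sum_set[OF distinct_unshufflings[OF S]]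
    by (intro sum.cong) auto
  also have "\<dots> = (if ?s \<in> set ?U then 1 else 0)" by simp
  also have "?s \<in> set ?U \<longleftrightarrow> (\<forall>xs\<in>set ?s. sorted_wrt (<) xs)"
  proof -
    have "word n \<sigma> \<in> words n" using bij_betw_word[of n] assms by (auto simp: bij_betw_def)
    then have "distinct (word n \<sigma>)" "set (word n \<sigma>) = set [1..<Suc n]"
      by (simp_all add: words_def atLeastLessThanSuc_atLeastAtMost del: upt_Suc)
    then have "mset (word n \<sigma>) = mset [1..<Suc n]"
      using set_eq_iff_mset_eq_distinct[OF _ distinct_upt] by blast
    then show ?thesis unfolding set_unshufflings[OF S] using map_length_segs[OF len] concat_segs[OF len] by simp
  qed
  finally show ?thesis using assms descents_subset_iff[OF assms] by (simp add: Xi_def)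
qed

text \<open>Right multiplication by \<open>w\<close> replaces each letter by its image under
  \<open>w\<close>, which commutes with unshuffling positions. So T applied to the word of
  \<open>w\<close> is the image under \<open>w\<close> of T applied to the identity word.\<close>

lemma gmul_Xi_delta:
  assumes "w \<in> perms n" "\<pi> \<in> perms n" "sum_list q = n"
  shows "gmul n (Xi n q) (delta w) \<pi> =
    (unshuffle q (word n w) (\<lambda>u. if u = word n \<pi> then 1 else 0) :: 'r::comm_ring_1)"
proof -
  have w: "w permutes {1..n}" "\<pi> permutes {1..n}" using assms by (auto simp: perms_def)
  have "map w u = word n \<pi> \<longleftrightarrow> u = word n (inv w \<circ> \<pi>)" for u
  proof
    assume "map w u = word n \<pi>"
    then have "map (inv w) (map w u) = word n (inv w \<circ> \<pi>)" by (simp add: word_comp)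
    then show "u = word n (inv w \<circ> \<pi>)" using permutes_inv_o(2)[OF w(1)] by simp
  next
    assume "u = word n (inv w \<circ> \<pi>)"
    then show "map w u = word n \<pi>"
      using permutes_inv_o(1)[OF w(1)] by (simp add: word_comp o_assoc)
  qed
  then have "(unshuffle q (word n w) (\<lambda>u. if u = word n \<pi> then 1 else 0) :: 'r) =
    unshuffle q [1..<Suc n] (\<lambda>u. if u = word n (inv w \<circ> \<pi>) then 1 else 0)"
    unfolding word_def[of n w] unshuffle_map by simp
  also have "\<dots> = Xi n q (inv w \<circ> \<pi>)"
    using w assms(3) by (intro unshuffle_upt_indicator) (auto simp: perms_def intro: permutes_compose permutes_inv)
  finally show ?thesis using assms by (simp add: gmul_delta)
qed

lemma mset_unshufflings: "xss \<in> set (unshufflings wt q w) \<Longrightarrow> mset (concat xss) = mset w"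
proof (induction q arbitrary: w xss)
  case (Cons m q)
  have sp: "(x, y) \<in> set (splits v) \<Longrightarrow> mset x + mset y = mset v" for x y v :: "'a list"
    by (induction v arbitrary: x y) auto
  obtain x y yss where "xss = x # yss" "(x, y) \<in> set (splits w)" "yss \<in> set (unshufflings wt q y)"
    using Cons.prems by (auto split: if_splits)
  then show ?case using Cons.IH sp by fastforce
qed (auto split: if_splits)

lemma unshuffle_expand:
  fixes g :: "nat list \<Rightarrow> 'r::comm_ring_1"
  assumes "w \<in> words n"
  shows "unshuffle q w g = (\<Sum>v\<in>words n. unshuffle q w (\<lambda>u. if u = v then 1 else 0) * g v)"
proof -
  have un: "unshuffle q w h = ev (map (\<lambda>xss. (1, concat xss)) (unshufflings length q w)) h" for h :: "nat list \<Rightarrow> 'r"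
    by (simp add: unshuffle_def ev_def o_def)
  show ?thesis unfolding un
    using assms by (intro ev_expand[OF finite_words]) (auto intro: words_mset dest: mset_unshufflings)
qed

text \<open>The first block of the remaining suffix ends at the least letter of that suffix, so its
  length is the distance to the next pivot.\<close>

lemma next_pivot_eq:
  assumes "inj \<sigma>" "\<rho> < n" "pivot_blocks (map \<sigma> [Suc \<rho>..<Suc n]) = v # vs"
  shows "next_pivot n \<sigma> \<rho> = \<rho> + length v" "\<rho> + length v \<le> n" "v \<noteq> []"
    "concat vs = map \<sigma> [Suc (\<rho> + length v)..<Suc n]"
proof -
  let ?L = "map \<sigma> [Suc \<rho>..<Suc n]"
  have L: "?L = v @ concat vs" using assms(3) by (metis concat_pivot_blocks concat.simps(2))
  have dist: "distinct ?L" using assms(1) by (auto simp: distinct_map intro: inj_on_subset)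
  have ml: "\<forall>u\<in>set (v # vs). min_last u" using min_last_pivot_blocks assms(3) by metis
  have sorted: "sorted_by last (v # vs)" using sorted_pivot_blocks[OF dist] assms(3) by simp
  show v: "v \<noteq> []" using ml by (simp add: min_last_def)
  have len: "length v + length (concat vs) = n - \<rho>" using arg_cong[OF L, of length] by (simp del: upt_Suc)
  then show le: "\<rho> + length v \<le> n" using assms(2) by simp
  have "concat vs = drop (length v) ?L" unfolding L by simp
  then show "concat vs = map \<sigma> [Suc (\<rho> + length v)..<Suc n]"
    by (simp add: drop_map add.commute del: upt_Suc)
  have min: "last u \<le> a" if "min_last u" "a \<in> set u" for u a
    using that by (cases u rule: rev_cases) (auto simp: min_last_def)
  \<comment> \<open>The list starts with position \<open>Suc \<rho>\<close>, so its index
    \<open>length v - 1\<close> is position \<open>\<rho> + length v\<close>.\<close>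
  have last: "last v = \<sigma> (\<rho> + length v)"
  proof -
    have "last v = ?L ! (length v - 1)" using v unfolding L by (simp add: last_conv_nth nth_append)
    also have "\<dots> = \<sigma> (Suc \<rho> + (length v - 1))"
    proof -
      have "0 < length v" using v by simp
      then have "length v - 1 < Suc n - Suc \<rho>" using len by linarith
      moreover from this have "Suc \<rho> + (length v - 1) < Suc n" by linarith
      ultimately show ?thesis by (simp del: upt_Suc)
    qed
    also have "Suc \<rho> + (length v - 1) = \<rho> + length v" using v by (cases v) auto
    finally show ?thesis .
  qed
  have smallest: "\<sigma> (\<rho> + length v) \<le> \<sigma> k" if "\<rho> < k" "k \<le> n" for k
  proof -
    have "\<sigma> k \<in> set ?L" using that by (auto simp del: upt_Suc)
    then consider "\<sigma> k \<in> set v" | u where "u \<in> set vs" "\<sigma> k \<in> set u" unfolding L by auto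
    then show ?thesis
    proof cases
      case 1
      then show ?thesis using min ml last by force
    next
      case 2
      then have "last v < last u" "last u \<le> \<sigma> k" using sorted min ml by auto
      then show ?thesis using last by simp
    qed
  qed
  show "next_pivot n \<sigma> \<rho> = \<rho> + length v"
    unfolding next_pivot_def
  proof (rule Least_equality)
    show "\<rho> < \<rho> + length v \<and> \<rho> + length v \<le> n \<and> (\<forall>k. \<rho> < k \<and> k \<le> n \<longrightarrow> \<sigma> (\<rho> + length v) \<le> \<sigma> k)"
      using v le smallest by simp
    fix j assume j: "\<rho> < j \<and> j \<le> n \<and> (\<forall>k. \<rho> < k \<and> k \<le> n \<longrightarrow> \<sigma> j \<le> \<sigma> k)"
    then have "\<sigma> j = \<sigma> (\<rho> + length v)" using smallest[of j] v le by (intro antisym) auto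
    then show "\<rho> + length v \<le> j" using assms(1) by (simp add: inj_eq)
  qed
qed

lemma pivot_parts_eq:
  assumes "inj \<sigma>"
  shows "pivot_parts n \<sigma> \<rho> = map length (pivot_blocks (map \<sigma> [Suc \<rho>..<Suc n]))"
  using assms
proof (induction n \<sigma> \<rho> rule: pivot_parts.induct)
  case (1 n \<sigma> \<rho>)
  show ?case
  proof (cases "\<rho> < n")
    case True
    then obtain v vs where p: "pivot_blocks (map \<sigma> [Suc \<rho>..<Suc n]) = v # vs"
      by (cases "pivot_blocks (map \<sigma> [Suc \<rho>..<Suc n])")
        (use concat_pivot_blocks[of "map \<sigma> [Suc \<rho>..<Suc n]"] in auto)
    note n = next_pivot_eq[OF 1(2) True p]
    \<comment> \<open>The blocks after the first form the pivot factorisation of the shorter suffix,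
      to which the induction hypothesis applies.\<close>
    have "vs = pivot_blocks (concat vs)"
    proof (rule pivot_blocks_concat[symmetric])
      have "distinct (map \<sigma> [Suc \<rho>..<Suc n])" using 1(2) by (auto simp: distinct_map intro: inj_on_subset)
      then show "sorted_by last vs" using sorted_pivot_blocks p by force
      show "\<forall>v\<in>set vs. min_last v" using min_last_pivot_blocks p by (metis list.set_intros(2))
    qed
    then show ?thesis using 1 True n p by (subst pivot_parts.simps) simp
  qed (subst pivot_parts.simps, simp)
qed

lemma pivot_cycle_type_eq:
  assumes "\<sigma> \<in> perms n"
  shows "pivot_cycle_type n \<sigma> = map length (pivot_blocks (word n \<sigma>))"
  using assms pivot_parts_eq[of \<sigma> n 0] by (simp add: pivot_cycle_type_def word_def perms_def permutes_inj)

lemma bij_betw_Bq: "bij_betw (word n) (Bq n q) (pivot_words n q)"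
  unfolding bij_betw_def
proof
  have b: "inj_on (word n) (perms n)" "word n ` perms n = words n"
    using bij_betw_word by (auto simp: bij_betw_def)
  show "inj_on (word n) (Bq n q)" by (rule inj_on_subset[OF b(1)]) (auto simp: Bq_def)
  have "word n ` Bq n q = word n ` {w \<in> perms n. weak_refines (mset (map length (pivot_blocks (word n w)))) q}"
    unfolding Bq_def by (intro arg_cong[of _ _ "image (word n)"] Collect_cong conj_cong refl)
      (simp add: pivot_cycle_type_eq)
  then show "word n ` Bq n q = pivot_words n q" unfolding pivot_words_def b(2)[symmetric] by auto
qed

section \<open>Counting by type\<close>

lemma zee_eq_prod:
  assumes "finite T" "set_mset p \<subseteq> T"
  shows "zee p = (\<Prod>i\<in>T. i ^ count p i * fact (count p i))"
  unfolding zee_def using assms by (intro prod.mono_neutral_left) (auto simp: not_in_iff)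

text \<open>Only the factor at \<open>m\<close> changes: for old multiplicity k, m^k k! becomes
  m^(k+1) (k+1)!.\<close>

lemma zee_add_mset: "zee (add_mset m r) = zee r * (m * Suc (count r m))"
proof -
  let ?T = "insert m (set_mset r)"
  have "zee (add_mset m r) = (\<Prod>i\<in>?T. i ^ count (add_mset m r) i * fact (count (add_mset m r) i))"
    by (rule zee_eq_prod) auto
  also have "\<dots> = m ^ Suc (count r m) * fact (Suc (count r m)) *
      (\<Prod>i\<in>?T - {m}. i ^ count r i * fact (count r i))"
    by (subst prod.remove[of _ m]) (auto intro!: prod.cong)
  also have "\<dots> = m * Suc (count r m) * (\<Prod>i\<in>?T. i ^ count r i * fact (count r i))"
    by (subst (2) prod.remove[of _ m]) (auto simp: algebra_simps)
  also have "(\<Prod>i\<in>?T. i ^ count r i * fact (count r i)) = zee r"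
    by (rule zee_eq_prod[symmetric]) auto
  finally show ?thesis by (simp add: algebra_simps)
qed

lemma zee_pos: "\<forall>x\<in>#p. 0 < x \<Longrightarrow> 0 < zee p"
  unfolding zee_def by (intro prod_pos) auto

section \<open>Counting by removal of the least letter\<close>

lemma sum_mset_eq_sum_count:
  assumes "finite T" "set_mset p \<subseteq> T"
  shows "sum_mset p = (\<Sum>m\<in>T. m * count p m)"
  using assms(2)
proof (induction p)
  case (add x p)
  have "(\<Sum>m\<in>T. m * count (add_mset x p) m) = (\<Sum>m\<in>T. (if m = x then x else 0) + m * count p m)"
    by (intro sum.cong) auto
  also have "\<dots> = x + (\<Sum>m\<in>T. m * count p m)" using assms(1) add.prems by (simp add: sum.distrib)
  finally show ?case using add by simp
qed simp

text \<open>The possible companions of the least letter, in order: the letters before it in the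
  first pivot block, or those after it in its cycle.\<close>

definition heads :: "nat set \<Rightarrow> nat list set" where
  "heads A = {v. distinct v \<and> set v \<subseteq> A - {Min A}}"

definition rest :: "nat set \<Rightarrow> nat list \<Rightarrow> nat set" where
  "rest A v = A - {Min A} - set v"

lemma heads_length:
  assumes "finite A" "A \<noteq> {}" "v \<in> heads A"
  shows "length v \<le> card A - 1" "card (rest A v) = card A - 1 - length v"
proof -
  have "card (set v) = length v" "set v \<subseteq> A - {Min A}" "card (A - {Min A}) = card A - 1"
    using assms by (auto simp: heads_def distinct_card)
  then show "length v \<le> card A - 1" "card (rest A v) = card A - 1 - length v"
    using assms(1) by (metis card_mono finite_Diff, simp add: rest_def card_Diff_subset)
qed

lemma finite_heads: "finite A \<Longrightarrow> finite (heads A)"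
  using finite_subset_distinct[of "A - {Min A}"] by (simp add: heads_def conj_commute)

text \<open>With N = \<open>card A - 1\<close> there are N!/(N - k)! heads of length k, so the
  weight (N - k)! gives every k the same total N!.\<close>

lemma sum_heads:
  fixes c :: "nat \<Rightarrow> nat"
  assumes "finite A" "A \<noteq> {}"
  shows "(\<Sum>v\<in>heads A. fact (card A - 1 - length v) * c (length v)) = fact (card A - 1) * (\<Sum>k\<le>card A - 1. c k)"
proof -
  let ?N = "card A - 1"
  have N: "card (A - {Min A}) = ?N" using assms by simp
  have "(\<Sum>v\<in>heads A. fact (?N - length v) * c (length v)) =
     (\<Sum>k\<le>?N. \<Sum>v\<in>{v\<in>heads A. length v = k}. fact (?N - length v) * c (length v))"
    using assms by (intro sum.group[symmetric] finite_heads) (auto dest: heads_length)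
  also have "\<dots> = (\<Sum>k\<le>?N. fact ?N * c k)"
  proof (intro sum.cong refl)
    fix k assume "k \<in> {..?N}"
    have "{v\<in>heads A. length v = k} = {v. length v = k \<and> distinct v \<and> set v \<subseteq> A - {Min A}}"
      by (auto simp: heads_def)
    then have "card {v\<in>heads A. length v = k} = \<Prod>{?N - k + 1..?N}"
      using card_lists_distinct_length_eq[of "A - {Min A}" k] assms \<open>k \<in> {..?N}\<close> N by simp
    then have "card {v\<in>heads A. length v = k} * fact (?N - k) = fact ?N"
      using fact_eq_fact_times[of "?N - k" ?N] by (simp add: mult.commute)
    then show "(\<Sum>v\<in>{v\<in>heads A. length v = k}. fact (?N - length v) * c (length v)) = fact ?N * c k"
      by (simp add: algebra_simps)
  qed
  finally show ?thesis by (simp add: sum_distrib_left)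
qed

text \<open>The recursion shared by both statistics. Let a head give the part m. If \<open>p\<close>
  arises from \<open>r\<close> by adding m, then \<open>zee p\<close> is \<open>zee r\<close> times
  m times the multiplicity of m in \<open>p\<close>, so by induction the head contributes (|A| - m)!
  times m times this multiplicity. Over all heads the total is (|A| - 1)! times the sum of the parts
  of \<open>p\<close>, which is |A|!.\<close>

lemma count_by_type:
  fixes X :: "nat set \<Rightarrow> 'x set" and ty :: "nat set \<Rightarrow> 'x \<Rightarrow> nat multiset"
  assumes X0: "X {} = {start}" "ty {} start = {#}"
    and fin: "\<And>A. finite A \<Longrightarrow> finite (X A)"
    and bij: "\<And>A. finite A \<Longrightarrow> A \<noteq> {} \<Longrightarrow> bij_betw (h A) (SIGMA v:heads A. X (rest A v)) (X A)"
    and ty: "\<And>A v x. finite A \<Longrightarrow> A \<noteq> {} \<Longrightarrow> v \<in> heads A \<Longrightarrow> x \<in> X (rest A v) \<Longrightarrow>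
      ty A (h A (v, x)) = add_mset (Suc (length v)) (ty (rest A v) x)"
    and A: "finite A" "sum_mset p = card A" "\<forall>x\<in>#p. 0 < x"
  shows "card {x \<in> X A. ty A x = p} * zee p = fact (card A)"
  using A
proof (induction "card A" arbitrary: A p rule: less_induct)
  case less
  show ?case
  proof (cases "A = {}")
    case True
    then have "p = {#}" using less.prems by (metis card.empty sum_mset_0_iff multiset_nonemptyE not_less_iff_gr_or_eq)
    moreover have "{x \<in> X {}. ty {} x = {#}} = {start}" using X0 by auto
    ultimately show ?thesis using True by (simp add: zee_def)
  next
    case False
    note fA = less.prems(1) False
    let ?N = "card A - 1"
    let ?G = "\<lambda>v. {x \<in> X (rest A v). add_mset (Suc (length v)) (ty (rest A v) x) = p}"
    have "{x \<in> X A. ty A x = p} = h A ` (SIGMA v:heads A. ?G v)"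
    proof -
      have "X A = h A ` (SIGMA v:heads A. X (rest A v))" using bij[OF fA] by (simp add: bij_betw_def)
      then show ?thesis using ty[OF fA] by (auto simp: image_iff)
    qed
    moreover have "inj_on (h A) (SIGMA v:heads A. ?G v)"
      using bij[OF fA] by (auto simp: bij_betw_def intro: inj_on_subset)
    ultimately have "card {x \<in> X A. ty A x = p} = card (SIGMA v:heads A. ?G v)"
      by (simp add: card_image)
    also have "\<dots> = (\<Sum>v\<in>heads A. card (?G v))"
      using finite_heads[OF fA(1)] fin fA(1) by (intro card_SigmaI) (auto simp: rest_def)
    finally have "card {x \<in> X A. ty A x = p} * zee p = (\<Sum>v\<in>heads A. card (?G v) * zee p)"
      by (simp add: sum_distrib_right)
    also have "\<dots> = (\<Sum>v\<in>heads A. fact (?N - length v) * (Suc (length v) * count p (Suc (length v))))"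
    proof (intro sum.cong refl)
      fix v assume v: "v \<in> heads A"
      let ?m = "Suc (length v)"
      show "card (?G v) * zee p = fact (?N - length v) * (?m * count p ?m)"
      proof (cases "?m \<in># p")
        case True
        then obtain r where r: "p = add_mset ?m r" by (metis mset_add)
        have "card A > 0" using fA by (simp add: card_gt_0_iff)
        then have lt: "card (rest A v) < card A" and sum: "sum_mset r = card (rest A v)"
          using heads_length[OF fA v] less.prems(2) r by auto
        have "finite (rest A v)" "\<forall>x\<in>#r. 0 < x" using less.prems r by (auto simp: rest_def)
        from less.hyps[OF lt this(1) sum this(2)]
        have "card (?G v) * zee r = fact (?N - length v)"
          using heads_length[OF fA v] r by simp
        moreover have "zee p = zee r * (?m * count p ?m)" unfolding r zee_add_mset by simp
        ultimately show ?thesis by (metis mult.assoc)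
      next
        case False
        then have "?G v = {}" by auto
        then show ?thesis using False by (simp only: card.empty not_in_iff)
      qed
    qed
    also have "\<dots> = fact ?N * (\<Sum>k\<le>?N. Suc k * count p (Suc k))"
      by (rule sum_heads[OF fA])
    \<comment> \<open>The shift m = k + 1 turns head lengths into part sizes; no part of
      \<open>p\<close> exceeds \<open>card A\<close>.\<close>
    also have "(\<Sum>k\<le>?N. Suc k * count p (Suc k)) = (\<Sum>m\<in>{Suc 0..Suc ?N}. m * count p m)"
      by (simp only: atLeast0AtMost[symmetric] sum.shift_bounds_cl_Suc_ivl)
    also have "\<dots> = sum_mset p"
    proof (rule sum_mset_eq_sum_count[symmetric])
      show "set_mset p \<subseteq> {Suc 0..Suc ?N}"
      proof
        fix x assume "x \<in># p"
        then have "x \<le> sum_mset p" by (metis le_add1 mset_add sum_mset.add_mset)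
        then show "x \<in> {Suc 0..Suc ?N}" using less.prems \<open>x \<in># p\<close> by fastforce
      qed
    qed simp
    finally show ?thesis using less.prems(2) fA by (simp add: fact_reduce[of "card A"] card_gt_0_iff)
  qed
qed

text \<open>A word is cut after its least letter. The prefix is the first pivot block, and the
  suffix is an arbitrary word on the remaining letters.\<close>

lemma card_pivot_type:
  assumes "finite A" "sum_mset p = card A" "\<forall>x\<in>#p. 0 < x"
  shows "card {w \<in> {w. distinct w \<and> set w = A}. mset (map length (pivot_blocks w)) = p} * zee p = fact (card A)"
proof (rule count_by_type[where ty = "\<lambda>_ w. mset (map length (pivot_blocks w))" and start = "[]"
      and h = "\<lambda>A (v, w). v @ Min A # w", OF _ _ _ _ _ assms])
  show "finite {w. distinct w \<and> set w = A}" if "finite A" for A :: "nat set"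
    by (rule finite_subset[OF _ finite_subset_distinct[OF that]]) auto
  fix A :: "nat set" assume A: "finite A" "A \<noteq> {}"
  then have "Min A \<in> A" by simp
  show "bij_betw (\<lambda>(v, w). v @ Min A # w) (SIGMA v:heads A. {w. distinct w \<and> set w = rest A v})
      {w. distinct w \<and> set w = A}"
    unfolding bij_betw_def
  proof
    show "inj_on (\<lambda>(v, w). v @ Min A # w) (SIGMA v:heads A. {w. distinct w \<and> set w = rest A v})"
    proof (rule inj_onI, clarify)
      fix v w v' w' assume *: "v @ Min A # w = v' @ Min A # w'" "v \<in> heads A" "v' \<in> heads A"
        "set w = rest A v" "set w' = rest A v'"
      then have "Min A \<notin> set v" "Min A \<notin> set w" by (auto simp: heads_def rest_def)
      then show "v = v' \<and> w = w'" using *(1) append_Cons_eq_iff[of "Min A" v w v' w'] by blast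
    qed
    show "(\<lambda>(v, w). v @ Min A # w) ` (SIGMA v:heads A. {w. distinct w \<and> set w = rest A v}) =
        {w. distinct w \<and> set w = A}"
    proof (intro equalityI subsetI)
      fix u assume "u \<in> (\<lambda>(v, w). v @ Min A # w) ` (SIGMA v:heads A. {w. distinct w \<and> set w = rest A v})"
      then show "u \<in> {w. distinct w \<and> set w = A}" using \<open>Min A \<in> A\<close> by (auto simp: heads_def rest_def)
    next
      fix u assume u: "u \<in> {w. distinct w \<and> set w = A}"
      define m where "m = Min A"
      have "m \<in> set u" using u \<open>Min A \<in> A\<close> by (simp add: m_def)
      then obtain v w where uv: "u = v @ m # w" by (blast dest: split_list)
      then have "v \<in> heads A" "distinct w" "set w = rest A v"
        using u unfolding heads_def rest_def m_def[symmetric] by auto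
      then show "u \<in> (\<lambda>(v, w). v @ Min A # w) ` (SIGMA v:heads A. {w. distinct w \<and> set w = rest A v})"
        using uv by (intro image_eqI[of _ _ "(v, w)"]) (auto simp: m_def)
    qed
  qed
  fix v w assume v: "v \<in> heads A" and w: "w \<in> {w. distinct w \<and> set w = rest A v}"
  have less: "Min A < b" if "b \<in> A - {Min A}" for b
    using that A by (metis Diff_iff Min_le insertI1 order_le_imp_less_or_eq)
  have "pivot_blocks ((v @ [Min A]) @ w) = (v @ [Min A]) # pivot_blocks w"
  proof (rule pivot_blocks_append)
    show "min_last (v @ [Min A])" using v less by (auto simp: min_last_def heads_def)
    show "\<forall>u\<in>set (pivot_blocks w). last (v @ [Min A]) < last u"
    proof
      fix u assume u: "u \<in> set (pivot_blocks w)"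
      then have "last u \<in> set u" using min_last_pivot_blocks[OF u] by (simp add: min_last_def)
      then have "last u \<in> set (concat (pivot_blocks w))" unfolding set_concat using u by blast
      then show "last (v @ [Min A]) < last u" using w less by (auto simp: rest_def)
    qed
  qed
  then show "mset (map length (pivot_blocks (case (v, w) of (v, w) \<Rightarrow> v @ Min A # w))) =
      add_mset (Suc (length v)) (mset (map length (pivot_blocks w)))"
    by simp
qed auto

section \<open>Splitting off the cycle of a given element\<close>

lemma cycle_of_list_funpow_nth:
  assumes "distinct cs" "i < length cs"
  shows "(cycle_of_list cs ^^ k) (cs ! i) = cs ! ((k + i) mod length cs)"
  using arg_cong[OF cyclic_rotation[OF assms(1), of k], of "\<lambda>xs. xs ! i"] assms(2)
  by (simp add: nth_rotate)

lemma cycle_comp_apply: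
  assumes "\<tau> permutes B" "set cs \<inter> B = {}"
  shows "x \<in> set cs \<Longrightarrow> (cycle_of_list cs \<circ> \<tau>) x = cycle_of_list cs x"
    "x \<notin> set cs \<Longrightarrow> (cycle_of_list cs \<circ> \<tau>) x = \<tau> x"
proof -
  show "(cycle_of_list cs \<circ> \<tau>) x = cycle_of_list cs x" if "x \<in> set cs"
  proof -
    have "x \<notin> B" using that assms(2) by blast
    then show ?thesis using permutes_not_in[OF assms(1)] by simp
  qed
  show "(cycle_of_list cs \<circ> \<tau>) x = \<tau> x" if "x \<notin> set cs"
  proof -
    have "\<tau> x \<notin> set cs" using that assms permutes_in_image[OF assms(1), of x] permutes_not_in[OF assms(1), of x]
      by (cases "x \<in> B") auto
    then show ?thesis by (simp add: id_outside_supp)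
  qed
qed

lemma cycle_comp_funpow:
  assumes "\<tau> permutes B" "set cs \<inter> B = {}"
  shows "x \<in> set cs \<Longrightarrow> ((cycle_of_list cs \<circ> \<tau>) ^^ k) x = (cycle_of_list cs ^^ k) x"
    "x \<in> B \<Longrightarrow> ((cycle_of_list cs \<circ> \<tau>) ^^ k) x = (\<tau> ^^ k) x"
proof -
  show "((cycle_of_list cs \<circ> \<tau>) ^^ k) x = (cycle_of_list cs ^^ k) x" if "x \<in> set cs"
  proof (induction k)
    case (Suc k)
    have "(cycle_of_list cs ^^ k) x \<in> set cs"
      using permutes_in_image[OF permutes_funpow[OF cycle_permutes]] that by metis
    then show ?case using Suc cycle_comp_apply(1)[OF assms] by simp
  qed simp
  show "((cycle_of_list cs \<circ> \<tau>) ^^ k) x = (\<tau> ^^ k) x" if "x \<in> B"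
  proof (induction k)
    case (Suc k)
    have "(\<tau> ^^ k) x \<in> B" using permutes_in_image[OF permutes_funpow[OF assms(1)]] that by metis
    then have "(\<tau> ^^ k) x \<notin> set cs" using assms(2) by blast
    then show ?case using Suc cycle_comp_apply(2)[OF assms] by simp
  qed simp
qed

lemma cyc_cycle_comp:
  assumes "\<tau> permutes B" "set cs \<inter> B = {}" "distinct cs"
  shows "x \<in> set cs \<Longrightarrow> cyc (cycle_of_list cs \<circ> \<tau>) x = set cs"
    "x \<in> B \<Longrightarrow> cyc (cycle_of_list cs \<circ> \<tau>) x = cyc \<tau> x"
proof -
  show "cyc (cycle_of_list cs \<circ> \<tau>) x = cyc \<tau> x" if "x \<in> B"
    using that by (simp add: cyc_def cycle_comp_funpow[OF assms(1,2)])
  assume x: "x \<in> set cs"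
  then obtain i where i: "i < length cs" "x = cs ! i" by (metis in_set_conv_nth)
  have c: "cyc (cycle_of_list cs \<circ> \<tau>) x = {cs ! ((k + i) mod length cs) |k. True}"
    using x i by (simp add: cyc_def cycle_comp_funpow[OF assms(1,2)] cycle_of_list_funpow_nth[OF assms(3)])
  show "cyc (cycle_of_list cs \<circ> \<tau>) x = set cs"
  proof
    show "cyc (cycle_of_list cs \<circ> \<tau>) x \<subseteq> set cs" unfolding c using i
      by (auto intro!: nth_mem mod_less_divisor)
    show "set cs \<subseteq> cyc (cycle_of_list cs \<circ> \<tau>) x"
    proof
      fix y assume "y \<in> set cs"
      then obtain j where "j < length cs" "y = cs ! j" by (metis in_set_conv_nth)
      \<comment> \<open>The exponent is j - i, raised by the length of the cycle to remain a natural
        number.\<close>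
      then have "y = cs ! ((j + (length cs - i) + i) mod length cs)" using i by simp
      then show "y \<in> cyc (cycle_of_list cs \<circ> \<tau>) x" unfolding c by blast
    qed
  qed
qed

text \<open>The recursion removes letters, so the cycle type is needed on arbitrary finite sets; on
  \<open>{1..n}\<close> it is \<open>cycle_type n\<close>.\<close>

definition cycle_type_on :: "nat set \<Rightarrow> perm \<Rightarrow> nat multiset" where
  "cycle_type_on A \<sigma> = image_mset card (mset_set (cyc \<sigma> ` A))"

lemma cycle_type_on_cycle_comp:
  assumes "\<tau> permutes B" "set cs \<inter> B = {}" "distinct cs" "cs \<noteq> []" "finite B"
  shows "cycle_type_on (set cs \<union> B) (cycle_of_list cs \<circ> \<tau>) = add_mset (length cs) (cycle_type_on B \<tau>)"
proof -
  have "cyc (cycle_of_list cs \<circ> \<tau>) ` (set cs \<union> B) = insert (set cs) (cyc \<tau> ` B)"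
    using cyc_cycle_comp[OF assms(1-3)] assms(4) by (cases cs) (auto simp: image_Un)
  moreover have "set cs \<notin> cyc \<tau> ` B"
  proof
    assume "set cs \<in> cyc \<tau> ` B"
    then obtain x where "x \<in> B" "set cs = cyc \<tau> x" by blast
    moreover have "(\<tau> ^^ 0) x \<in> cyc \<tau> x" unfolding cyc_def by blast
    ultimately show False using assms(2) by auto
  qed
  ultimately show ?thesis using assms(3,5) by (simp add: cycle_type_on_def distinct_card)
qed

text \<open>The cycle lists the orbit of \<open>a\<close> in the order of iteration. It agrees with
  \<sigma> on that orbit, so composing \<sigma> with its inverse fixes the orbit pointwise.\<close>

lemma cycle_comp_surj:
  assumes "\<sigma> permutes A" "finite A" "a \<in> A"
  obtains v \<tau> where "distinct (a # v)" "set v \<subseteq> A" "\<tau> permutes (A - set (a # v))"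
    "\<sigma> = cycle_of_list (a # v) \<circ> \<tau>"
proof -
  define cs where "cs = support \<sigma> a"
  have perm: "permutation \<sigma>" using assms permutation_permutes by blast
  have l: "least_power \<sigma> a > 0" "(\<sigma> ^^ least_power \<sigma> a) a = a"
    using least_power_of_permutation[OF perm] by auto
  have nth: "cs ! i = (\<sigma> ^^ i) a" if "i < least_power \<sigma> a" for i using that by (simp add: cs_def)
  have len: "length cs = least_power \<sigma> a" by (simp add: cs_def)
  define v where "v = map (\<lambda>i. (\<sigma> ^^ i) a) [1..<least_power \<sigma> a]"
  have v: "cs = a # v" using l by (simp add: upt_conv_Cons v_def cs_def)
  have dist: "distinct cs" unfolding cs_def by (rule cycle_of_permutation[OF perm])
  have sub: "set cs \<subseteq> A"
  proof
    fix x assume "x \<in> set cs"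
    then obtain i where "x = (\<sigma> ^^ i) a" by (auto simp: cs_def)
    then show "x \<in> A" using permutes_in_image[OF permutes_funpow[OF assms(1), of i], of a] assms(3) by simp
  qed
  define c where "c = cycle_of_list cs"
  have c: "c permutes set cs" unfolding c_def by (rule cycle_permutes)
  then have cA: "c permutes A" using sub by (rule permutes_subset)
  define \<tau> where "\<tau> = inv c \<circ> \<sigma>"
  have "c x = \<sigma> x" if "x \<in> set cs" for x
  proof -
    obtain i where "i < length cs" and x: "x = cs ! i"
      using \<open>x \<in> set cs\<close> by (metis in_set_conv_nth)
    then have i: "i < least_power \<sigma> a" using len by simp
    have "c x = cs ! (Suc i mod least_power \<sigma> a)"
      using cycle_of_list_funpow_nth[OF dist, of i 1] i unfolding c_def x by (simp add: len)
    also have "\<dots> = (\<sigma> ^^ (Suc i mod least_power \<sigma> a)) a" using l by (intro nth) simp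
    \<comment> \<open>At the last entry the exponent wraps to 0, matching the return of \<sigma> to
      \<open>a\<close>.\<close>
    also have "\<dots> = (\<sigma> ^^ Suc i) a"
      using i l by (cases "Suc i = least_power \<sigma> a") auto
    finally show ?thesis using nth[OF i] x by simp
  qed
  then have "\<tau> x = x" if "x \<in> set cs" for x
    using that permutes_inverses(2)[OF c, of x] by (simp only: \<tau>_def o_apply)
  moreover have "\<tau> permutes A" unfolding \<tau>_def
    by (intro permutes_compose[OF assms(1)] permutes_inv cA)
  ultimately have "\<tau> permutes (A - set cs)"
    by - (rule permutes_superset[of \<tau> A], auto)
  moreover have "\<sigma> = c \<circ> \<tau>" using permutes_inv_o(1)[OF c] by (simp add: \<tau>_def o_assoc)
  ultimately show thesis
    using that[of v \<tau>] dist sub unfolding c_def v by simp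
qed

text \<open>The orbit of \<open>a\<close> gives the length of the cycle, the iterates of
  \<open>a\<close> give its entries in order, and the cycle can then be cancelled.\<close>

lemma cycle_comp_inj:
  fixes a :: nat
  assumes "\<tau> permutes B" "set (a # v) \<inter> B = {}" "distinct (a # v)"
    and "\<tau>' permutes B'" "set (a # v') \<inter> B' = {}" "distinct (a # v')"
    and eq: "cycle_of_list (a # v) \<circ> \<tau> = cycle_of_list (a # v') \<circ> \<tau>'"
  shows "v = v' \<and> \<tau> = \<tau>'"
proof -
  have "set (a # v) = set (a # v')"
    using cyc_cycle_comp(1)[OF assms(1-3), of a] cyc_cycle_comp(1)[OF assms(4-6), of a] eq by simp
  then have len: "length (a # v) = length (a # v')" using assms(3,6) by (metis distinct_card)
  have "a # v = a # v'"
  proof (rule nth_equalityI[OF len])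
    fix i assume i: "i < length (a # v)"
    have "(a # v) ! i = (cycle_of_list (a # v) ^^ i) a"
      using cycle_of_list_funpow_nth[OF assms(3), of 0 i] i by simp
    also have "\<dots> = (cycle_of_list (a # v') ^^ i) a"
      using cycle_comp_funpow(1)[OF assms(1,2), of a i] cycle_comp_funpow(1)[OF assms(4,5), of a i] eq by simp
    also have "\<dots> = (a # v') ! i"
      using cycle_of_list_funpow_nth[OF assms(6), of 0 i] i len by simp
    finally show "(a # v) ! i = (a # v') ! i" .
  qed
  moreover have "inj (cycle_of_list (a # v))" using cycle_permutes permutes_inj by blast
  ultimately show ?thesis using eq by (simp add: fun_eq_iff inj_eq)
qed

text \<open>Writing the cycle of the least letter with that letter first makes its notation unique;
  what remains is an arbitrary permutation of the other letters.\<close>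

lemma card_cycle_type:
  assumes "finite A" "sum_mset p = card A" "\<forall>x\<in>#p. 0 < x"
  shows "card {\<sigma> \<in> {\<sigma>. \<sigma> permutes A}. cycle_type_on A \<sigma> = p} * zee p = fact (card A)"
proof (rule count_by_type[where ty = cycle_type_on and start = id
      and h = "\<lambda>A (v, \<tau>). cycle_of_list (Min A # v) \<circ> \<tau>", OF _ _ _ _ _ assms])
  fix A :: "nat set" assume A: "finite A" "A \<noteq> {}"
  then have min: "Min A \<in> A" by simp
  have h: "distinct (Min A # v)" "set (Min A # v) \<inter> rest A v = {}" "set (Min A # v) \<union> rest A v = A"
    "rest A v = A - set (Min A # v)" if "v \<in> heads A" for v
    using that min by (auto simp: heads_def rest_def)
  show "bij_betw (\<lambda>(v, \<tau>). cycle_of_list (Min A # v) \<circ> \<tau>) (SIGMA v:heads A. {\<tau>. \<tau> permutes rest A v}) {\<sigma>. \<sigma> permutes A}"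
    unfolding bij_betw_def
  proof
    show "inj_on (\<lambda>(v, \<tau>). cycle_of_list (Min A # v) \<circ> \<tau>) (SIGMA v:heads A. {\<tau>. \<tau> permutes rest A v})"
    proof (rule inj_onI, clarify)
      fix v \<tau> v' \<tau>'
      assume "v \<in> heads A" "v' \<in> heads A" "\<tau> permutes rest A v" "\<tau>' permutes rest A v'"
        "cycle_of_list (Min A # v) \<circ> \<tau> = cycle_of_list (Min A # v') \<circ> \<tau>'"
      then show "v = v' \<and> \<tau> = \<tau>'" using h by (intro cycle_comp_inj) auto
    qed
    show "(\<lambda>(v, \<tau>). cycle_of_list (Min A # v) \<circ> \<tau>) ` (SIGMA v:heads A. {\<tau>. \<tau> permutes rest A v}) = {\<sigma>. \<sigma> permutes A}"
    proof (intro equalityI subsetI)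
      fix \<sigma> assume "\<sigma> \<in> (\<lambda>(v, \<tau>). cycle_of_list (Min A # v) \<circ> \<tau>) ` (SIGMA v:heads A. {\<tau>. \<tau> permutes rest A v})"
      then obtain v \<tau> where *: "\<sigma> = cycle_of_list (Min A # v) \<circ> \<tau>" "v \<in> heads A" "\<tau> permutes rest A v" by auto
      have "rest A v \<subseteq> A" "set (Min A # v) \<subseteq> A" using h(3)[OF *(2)] by blast+
      then have "\<tau> permutes A" "cycle_of_list (Min A # v) permutes A"
        using permutes_subset[OF *(3)] permutes_subset[OF cycle_permutes] by blast+
      then show "\<sigma> \<in> {\<sigma>. \<sigma> permutes A}" using *(1) by (simp add: permutes_compose)
    next
      fix \<sigma> assume "\<sigma> \<in> {\<sigma>. \<sigma> permutes A}"
      then have "\<sigma> permutes A" by simp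
      then obtain v \<tau> where *: "distinct (Min A # v)" "set v \<subseteq> A" "\<tau> permutes (A - set (Min A # v))"
        "\<sigma> = cycle_of_list (Min A # v) \<circ> \<tau>" by (rule cycle_comp_surj[OF _ A(1) min])
      then have v: "v \<in> heads A" by (auto simp: heads_def)
      then have "\<tau> permutes rest A v" using *(3) h(4)[OF v] by simp
      then show "\<sigma> \<in> (\<lambda>(v, \<tau>). cycle_of_list (Min A # v) \<circ> \<tau>) ` (SIGMA v:heads A. {\<tau>. \<tau> permutes rest A v})"
        using v *(4) by (intro image_eqI[of _ _ "(v, \<tau>)"]) simp_all
    qed
  qed
  fix v \<tau> assume v: "v \<in> heads A" "\<tau> \<in> {\<tau>. \<tau> permutes rest A v}"
  have "finite (rest A v)" using A(1) by (simp add: rest_def)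
  then have "cycle_type_on (set (Min A # v) \<union> rest A v) (cycle_of_list (Min A # v) \<circ> \<tau>) =
      add_mset (length (Min A # v)) (cycle_type_on (rest A v) \<tau>)"
    using h(1,2)[OF v(1)] v(2) by (intro cycle_type_on_cycle_comp) simp_all
  then show "cycle_type_on A (case (v, \<tau>) of (v, \<tau>) \<Rightarrow> cycle_of_list (Min A # v) \<circ> \<tau>) =
      add_mset (Suc (length v)) (cycle_type_on (rest A v) \<tau>)"
    unfolding h(3)[OF v(1)] by simp
qed (auto simp: cycle_type_on_def finite_permutations)

section \<open>Partitions refining a composition and the final assembly\<close>

lemma weak_refines_partition:
  assumes "weak_refines p q" "q \<in> compositions n"
  shows "p \<in> partitions n"
proof -
  obtain rs where rs: "length rs = length q" "\<forall>i<length q. rs ! i \<in> compositions (q ! i)"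
    "mset (concat rs) = p" using assms(1) by (auto simp: weak_refines_def)
  have "map sum_list rs = q" using rs(1,2) by (intro nth_equalityI) (auto simp: compositions_def)
  moreover have "sum_list (concat rs) = sum_list (map sum_list rs)" by (induction rs) auto
  ultimately have "sum_mset p = n"
    using assms(2) unfolding rs(3)[symmetric] sum_mset_sum_list by (simp add: compositions_def)
  moreover have "0 < x" if "x \<in># p" for x
  proof -
    have "x \<in> set (concat rs)" using that rs(3) by (metis set_mset_mset)
    then obtain r where "r \<in> set rs" "x \<in> set r" by auto
    then show ?thesis using rs(1,2) by (metis (mono_tags, lifting) compositions_def in_set_conv_nth mem_Collect_eq)
  qed
  ultimately show ?thesis by (simp add: partitions_def)
qed

lemma finite_partitions: "finite (partitions n)"
proof (rule finite_subset)
  show "partitions n \<subseteq> mset ` {xs. set xs \<subseteq> {0..n} \<and> length xs \<le> n}"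
  proof
    fix p assume p: "p \<in> partitions n"
    obtain xs where xs: "mset xs = p" using ex_mset by blast
    then have pos: "\<forall>x\<in>set xs. 0 < x" and sum: "sum_list xs = n"
      using p by (auto simp: partitions_def sum_mset_sum_list)
    have "length xs \<le> sum_list xs" using pos by (induction xs) auto
    moreover have "\<forall>x\<in>set xs. x \<le> sum_list xs" by (simp add: member_le_sum_list)
    ultimately show "p \<in> mset ` {xs. set xs \<subseteq> {0..n} \<and> length xs \<le> n}"
      using xs sum by (intro image_eqI[of _ _ xs]) auto
  qed
qed (simp add: finite_lists_length_le)

lemma card_weak_refines:
  assumes "finite Y" "q \<in> compositions n"
  shows "card {y \<in> Y. weak_refines (ty y) q} =
    (\<Sum>p\<in>{p \<in> partitions n. weak_refines p q}. card {y \<in> Y. ty y = p})"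
proof -
  let ?P = "{p \<in> partitions n. weak_refines p q}" and ?Y = "{y \<in> Y. weak_refines (ty y) q}"
  have "(\<Sum>p\<in>?P. \<Sum>y\<in>{y \<in> ?Y. ty y = p}. 1) = (\<Sum>y\<in>?Y. 1::nat)"
    using assms finite_partitions[of n] weak_refines_partition[OF _ assms(2)]
    by (intro sum.group) auto
  moreover have "{y \<in> ?Y. ty y = p} = {y \<in> Y. ty y = p}" if "p \<in> ?P" for p
    using that by auto
  ultimately show ?thesis by simp
qed

theorem mainTheorem16:
  fixes n :: nat and q :: "nat list"
  assumes "q \<in> compositions n"
  shows "(\<forall>x::perm \<Rightarrow> 'r::comm_ring_1. x \<in> group_ring n \<longrightarrow>
            (\<exists>c. gmul n (Xi n q) x = (\<lambda>\<pi>. \<Sum>w\<in>Bq n q. c w * gmul n (Xi n q) (delta w) \<pi>)))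
       \<and> (\<forall>c::perm \<Rightarrow> 'r.
            (\<lambda>\<pi>. \<Sum>w\<in>Bq n q. c w * gmul n (Xi n q) (delta w) \<pi>) = (\<lambda>_. 0)
            \<longrightarrow> (\<forall>w\<in>Bq n q. c w = 0))
       \<and> real (card (Bq n q)) =
           (\<Sum>p\<in>{p\<in>partitions n. weak_refines p q}. fact n / real (zee p))
       \<and> card (Bq n q) = card {\<sigma>\<in>perms n. weak_refines (cycle_type n \<sigma>) q}"
proof (intro conjI allI impI)
  have q: "sum_list q = n" using assms by (simp add: compositions_def)
  have BP: "Bq n q \<subseteq> perms n" by (auto simp: Bq_def)
  have inj: "inj_on (word n) (perms n)" and words: "word n ` perms n = words n"
    using bij_betw_word[of n] by (auto simp: bij_betw_def)
  have B: "bij_betw (word n) (Bq n q) (pivot_words n q)" by (rule bij_betw_Bq)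
  let ?X = "\<lambda>w. gmul n (Xi n q) (delta w) :: perm \<Rightarrow> 'r"
  have coeff: "?X w \<pi> = (if \<pi> \<in> perms n
      then unshuffle q (word n w) (\<lambda>u. if u = word n \<pi> then 1 else 0) else 0)" if "w \<in> perms n" for w \<pi>
  proof (cases "\<pi> \<in> perms n")
    case True
    then show ?thesis by (simp add: gmul_Xi_delta[OF that _ q])
  next
    case False
    then show ?thesis by (simp add: gmul_delta[OF that])
  qed
  {
    fix x :: "perm \<Rightarrow> 'r"
    \<comment> \<open>By linearity in \<open>x\<close> it suffices to express the products with
      single permutations.\<close>
    have "\<forall>w\<in>perms n. \<exists>c. \<forall>\<pi>. ?X w \<pi> = (\<Sum>v\<in>Bq n q. c v * ?X v \<pi>)"
    proof
      fix w assume w: "w \<in> perms n"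
      then have "word n w \<in> words n" using words by blast
      then obtain c where c: "\<forall>g. (unshuffle q (word n w) g :: 'r) =
          (\<Sum>v\<in>pivot_words n q. c v * unshuffle q v g)"
        using unshuffle_basis(2)[OF assms, where 'r = 'r] by blast
      have "?X w \<pi> = (\<Sum>v\<in>Bq n q. c (word n v) * ?X v \<pi>)" for \<pi>
      proof (cases "\<pi> \<in> perms n")
        case True
        let ?g = "\<lambda>u. if u = word n \<pi> then 1 else 0 :: 'r"
        have "?X w \<pi> = (\<Sum>v\<in>pivot_words n q. c v * unshuffle q v ?g)"
          using coeff[OF w, of \<pi>] c[rule_format, of ?g] True by simp
        also have "\<dots> = (\<Sum>v\<in>Bq n q. c (word n v) * unshuffle q (word n v) ?g)"
          by (rule sum.reindex_bij_betw[OF B, symmetric])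
        also have "\<dots> = (\<Sum>v\<in>Bq n q. c (word n v) * ?X v \<pi>)"
          using True BP by (intro sum.cong refl) (simp add: coeff subset_iff)
        finally show ?thesis .
      next
        case False
        then show ?thesis using w BP by (simp add: coeff subset_iff)
      qed
      then show "\<exists>c. \<forall>\<pi>. ?X w \<pi> = (\<Sum>v\<in>Bq n q. c v * ?X v \<pi>)"
        by (intro exI[of _ "\<lambda>v. c (word n v)"]) simp
    qed
    then obtain c where c: "\<forall>w\<in>perms n. \<forall>\<pi>. ?X w \<pi> = (\<Sum>v\<in>Bq n q. c w v * ?X v \<pi>)"
      by (rule bchoice[THEN exE])
    have "gmul n (Xi n q) x \<pi> = (\<Sum>v\<in>Bq n q. (\<Sum>w\<in>perms n. x w * c w v) * ?X v \<pi>)" for \<pi>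
    proof -
      have "gmul n (Xi n q) x \<pi> = (\<Sum>w\<in>perms n. x w * (\<Sum>v\<in>Bq n q. c w v * ?X v \<pi>))"
        unfolding gmul_sum_delta[of n "Xi n q" x] using c by (intro sum.cong refl) (metis (no_types))
      also have "\<dots> = (\<Sum>w\<in>perms n. \<Sum>v\<in>Bq n q. x w * c w v * ?X v \<pi>)"
        by (simp add: sum_distrib_left mult.assoc)
      also have "\<dots> = (\<Sum>v\<in>Bq n q. (\<Sum>w\<in>perms n. x w * c w v) * ?X v \<pi>)"
        by (subst sum.swap) (simp add: sum_distrib_right)
      finally show ?thesis .
    qed
    then show "\<exists>c. gmul n (Xi n q) x = (\<lambda>\<pi>. \<Sum>w\<in>Bq n q. c w * ?X w \<pi>)"
      by (intro exI[of _ "\<lambda>v. \<Sum>w\<in>perms n. x w * c w v"]) (simp add: fun_eq_iff)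
  }
  {
    fix c :: "perm \<Rightarrow> 'r"
    assume "(\<lambda>\<pi>. \<Sum>w\<in>Bq n q. c w * ?X w \<pi>) = (\<lambda>_. 0)"
    then have zero: "(\<Sum>w\<in>Bq n q. c w * ?X w \<pi>) = 0" for \<pi> by (rule fun_cong)
    \<comment> \<open>The coefficients are carried over from permutations to words.\<close>
    define d where "d u = c (inv_into (Bq n q) (word n) u)" for u
    have d: "d (word n w) = c w" if "w \<in> Bq n q" for w
      using that bij_betw_imp_inj_on[OF B] by (simp add: d_def)
    \<comment> \<open>Every pairing with a functional is determined by the coefficients at
      permutations, so a relation among group ring elements holds for all \<open>g\<close>.\<close>
    have expand: "unshuffle q (word n w) g = (\<Sum>\<pi>\<in>perms n. ?X w \<pi> * g (word n \<pi>))"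
      if "w \<in> perms n" for w g
    proof -
      have "word n w \<in> words n" using that words by blast
      then have "unshuffle q (word n w) g =
          (\<Sum>v\<in>words n. unshuffle q (word n w) (\<lambda>u. if u = v then 1 else 0) * g v)"
        by (rule unshuffle_expand)
      also have "\<dots> = (\<Sum>\<pi>\<in>perms n. unshuffle q (word n w) (\<lambda>u. if u = word n \<pi> then 1 else 0) * g (word n \<pi>))"
        by (rule sum.reindex_bij_betw[OF bij_betw_word, symmetric])
      finally show ?thesis using coeff[OF that] by simp
    qed
    have "(\<Sum>u\<in>pivot_words n q. d u * unshuffle q u g) = 0" for g
    proof -
      have "(\<Sum>u\<in>pivot_words n q. d u * unshuffle q u g) =
          (\<Sum>w\<in>Bq n q. d (word n w) * unshuffle q (word n w) g)"
        by (rule sum.reindex_bij_betw[OF B, symmetric])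
      also have "\<dots> = (\<Sum>w\<in>Bq n q. \<Sum>\<pi>\<in>perms n. c w * ?X w \<pi> * g (word n \<pi>))"
        using BP by (intro sum.cong refl) (auto simp: d expand sum_distrib_left mult.assoc)
      also have "\<dots> = (\<Sum>\<pi>\<in>perms n. (\<Sum>w\<in>Bq n q. c w * ?X w \<pi>) * g (word n \<pi>))"
        by (subst sum.swap) (simp add: sum_distrib_right)
      finally show ?thesis by (simp add: zero)
    qed
    then have "d u = 0" if "u \<in> pivot_words n q" for u
      using lin_indepD[OF unshuffle_basis(1)[OF assms], of d] that by blast
    then show "\<forall>w\<in>Bq n q. c w = 0"
      using d bij_betwE[OF B] by metis
  }
  let ?P = "{p \<in> partitions n. weak_refines p q}"
  have P: "sum_mset p = card {1..n}" "\<forall>x\<in>#p. 0 < x" "0 < zee p" if "p \<in> ?P" for p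
    using that zee_pos by (auto simp: partitions_def)
  have "card (Bq n q) = card (pivot_words n q)" by (rule bij_betw_same_card[OF B])
  also have "\<dots> = (\<Sum>p\<in>?P. card {w \<in> words n. mset (map length (pivot_blocks w)) = p})"
    unfolding pivot_words_def by (rule card_weak_refines[OF finite_words assms])
  finally have cB: "card (Bq n q) = (\<Sum>p\<in>?P. card {w \<in> words n. mset (map length (pivot_blocks w)) = p})" .
  have w: "card {w \<in> words n. mset (map length (pivot_blocks w)) = p} * zee p = fact n" if "p \<in> ?P" for p
    using card_pivot_type[OF _ P(1,2)[OF that]] unfolding words_def by simp
  have c: "card {\<sigma> \<in> perms n. cycle_type n \<sigma> = p} * zee p = fact n" if "p \<in> ?P" for p
    using card_cycle_type[OF _ P(1,2)[OF that]]
    unfolding perms_def cycle_type_def cycle_type_on_def by simp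
  have "real (card {w \<in> words n. mset (map length (pivot_blocks w)) = p}) = fact n / real (zee p)"
    if "p \<in> ?P" for p
  proof -
    have "real (card {w \<in> words n. mset (map length (pivot_blocks w)) = p}) * real (zee p) = fact n"
      using arg_cong[OF w[OF that], of real] by simp
    then show ?thesis using P(3)[OF that] by (simp add: field_simps)
  qed
  then show "real (card (Bq n q)) = (\<Sum>p\<in>?P. fact n / real (zee p))"
    unfolding cB by (simp only: of_nat_sum cong: sum.cong)
  \<comment> \<open>Both counts become \<open>fact n\<close> when multiplied by the positive number
    \<open>zee p\<close>.\<close>
  have "card {w \<in> words n. mset (map length (pivot_blocks w)) = p} = card {\<sigma> \<in> perms n. cycle_type n \<sigma> = p}"
    if "p \<in> ?P" for p
    using w[OF that] c[OF that] P(3)[OF that] by (metis mult_right_cancel less_numeral_extra(3))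
  then show "card (Bq n q) = card {\<sigma>\<in>perms n. weak_refines (cycle_type n \<sigma>) q}"
    unfolding cB card_weak_refines[OF finite_perms assms] by (rule sum.cong[OF refl])
qed

end
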